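(* Let $\Gamma=(\mathcal{P},\mathcal{L},\mathtt{I})$ be a finite thick generalised $2m$-gon of order $(s,t)$ with $s\le t$ and $m>1$. Let $\mathbb{F}$ be a field such that none of the $m-1$ elements $\sum_{j=0}^{k}(-s)^j$, $k\in\{1,\dots,m-1\}$, is $0$ in $\mathbb{F}$. Then the minimum weight of the nonzero code words of $\mathfrak{C}_{\mathbb{F}}(\Gamma)$ is $s+1$, and the support of any code word of weight $s+1$ is a distance $d$-trace $T_{d,x,y}$ for some $d\in\{1,\dots,m\}$ and some opposite elements $x,y$. Furthermore, if $s<t$, then $d$ is odd. In particular, if $\Gamma$ is a thick generalised quadrangle ($m=2$) of order $(s,t)$ with $s<t$, then every minimum weight code word of $\mathfrak{C}_{\mathbb{F}}(\Gamma)$ is a nonzero scalar multiple of $\mathfrak{i}_L$ for some line $L$.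
   Context: A point-line geometry $\Gamma=(\mathcal{P},\mathcal{L},\mathtt{I})$ consists of a set of points $\mathcal{P}$, a set of lines $\mathcal{L}$ and a symmetric incidence relation between points and lines; an element is a point or a line. Its incidence graph is the bipartite graph on $\mathcal{P}\cup\mathcal{L}$ with $x\sim y$ iff $x\,\mathtt{I}\,y$, and $\delta(x,y)$ denotes distance in this graph. For $n\ge3$, a weak generalised $n$-gon is a point-line geometry containing no ordinary $k$-gon as subgeometry for $2\le k<n$ and such that any two elements lie in a common ordinary $n$-gon (its incidence graph then has diameter $n$ and girth $2n$). It has order $(s,t)$ ($s,t\ge1$ integers) if every line is incident with exactly $s+1$ points and every point with exactly $t+1$ lines. It is thick if moreover every point is on at least three lines and every line on at least three points. A (thick) generalised quadrangle is the case $n=4$. Two elements are opposite if their distance is $n$. For an element $x$ and an integer $i$: $\mathcal{P}_i(x)$ (resp. $\mathcal{P}_{\le i}(x)$) is the set of points at distance exactly $i$ (resp. at most $i$) from $x$. For $d\in\{1,\dots,m\}$ and opposite elements $x,y$ of a weak generalised $2m$-gon, the distance $d$-trace is $T_{d,x,y}=\mathcal{P}_d(x)\cap\mathcal{P}_{2m-d}(y)$ (required to be nonempty). For a field $\mathbb{F}$, integers are interpreted in $\mathbb{F}$ via $k\mapsto k\cdot 1_{\mathbb{F}}$. $\mathbb{F}\mathcal{P}$ is the vector space of functions $\mathcal{P}\to\mathbb{F}$; for $S\subseteq\mathcal{P}$, $\mathfrak{i}_S$ is its indicator function, and for a line $L$, $\mathfrak{i}_L=\mathfrak{i}_{\mathcal{P}_1(L)}$.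 The support of $\mathfrak{f}$ is $\{x:\mathfrak{f}(x)\ne0\}$ and its weight is the size of its support. The code $\mathfrak{C}_{\mathbb{F}}(\Gamma)$ is the subspace of $\mathbb{F}\mathcal{P}$ spanned by $\{\mathfrak{i}_L: L\in\mathcal{L}\}$. *)

theory Defs
  imports
    Complex_Main
    "HOL-Library.Extended_Nat"
    "HOL-Library.Indicator_Function"
    "HOL-Library.Function_Algebras"
begin

section \<open>Point-line geometries\<close>

text \<open>Points and lines live in different types, so an element is a member of the sum
  \<open>points \<Gamma> <+> lines \<Gamma>\<close>. The relation \<open>inc\<close> records the (point, line) half of the
  symmetric incidence relation.\<close>

record ('p, 'l) geometry =
  points :: "'p set"
  lines :: "'l set"
  inc :: "('p \<times> 'l) set"

definition point_line_geometry :: "('p, 'l) geometry \<Rightarrow> bool" where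
  "point_line_geometry \<Gamma> \<longleftrightarrow> inc \<Gamma> \<subseteq> points \<Gamma> \<times> lines \<Gamma>"

definition elements :: "('p, 'l) geometry \<Rightarrow> ('p + 'l) set" where
  "elements \<Gamma> = points \<Gamma> <+> lines \<Gamma>"

definition finite_geometry :: "('p, 'l) geometry \<Rightarrow> bool" where
  "finite_geometry \<Gamma> \<longleftrightarrow> finite (points \<Gamma>) \<and> finite (lines \<Gamma>)"

definition subgeometry :: "('p, 'l) geometry \<Rightarrow> ('p, 'l) geometry \<Rightarrow> bool" where
  "subgeometry \<Delta> \<Gamma> \<longleftrightarrow>
     points \<Delta> \<subseteq> points \<Gamma> \<and> lines \<Delta> \<subseteq> lines \<Gamma> \<and>
     inc \<Delta> = inc \<Gamma> \<inter> (points \<Delta> \<times> lines \<Delta>)"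

definition ordinary_polygon :: "nat \<Rightarrow> ('p, 'l) geometry \<Rightarrow> bool" where
  "ordinary_polygon k \<Delta> \<longleftrightarrow>
     2 \<le> k \<and>
     (\<exists>p l. bij_betw p {..<k} (points \<Delta>) \<and> bij_betw l {..<k} (lines \<Delta>) \<and>
        inc \<Delta> = (\<Union>i<k. {(p i, l i), (p (Suc i mod k), l i)}))"


section \<open>The incidence graph\<close>

definition incidence_graph :: "('p, 'l) geometry \<Rightarrow> ('p + 'l) rel" where
  "incidence_graph \<Gamma> =
     {(Inl p, Inr l) | p l. (p, l) \<in> inc \<Gamma>} \<union> {(Inr l, Inl p) | p l. (p, l) \<in> inc \<Gamma>}"

text \<open>The infimum over the lengths of all walks; it is \<open>\<infinity>\<close> for unconnected elements.\<close>

definition distance :: "('p, 'l) geometry \<Rightarrow> 'p + 'l \<Rightarrow> 'p + 'l \<Rightarrow> enat" where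
  "distance \<Gamma> x y = (INF n\<in>{n. (x, y) \<in> incidence_graph \<Gamma> ^^ n}. enat n)"

definition points_at :: "('p, 'l) geometry \<Rightarrow> nat \<Rightarrow> 'p + 'l \<Rightarrow> 'p set" where
  "points_at \<Gamma> i x = {p \<in> points \<Gamma>. distance \<Gamma> x (Inl p) = enat i}"


section \<open>Generalised polygons\<close>

text \<open>The empty geometry has to be excluded explicitly: it satisfies the remaining conditions
  vacuously, although its incidence graph does not have diameter \<open>n\<close>.\<close>

definition weak_generalised_polygon :: "nat \<Rightarrow> ('p, 'l) geometry \<Rightarrow> bool" where
  "weak_generalised_polygon n \<Gamma> \<longleftrightarrow>
     3 \<le> n \<and> point_line_geometry \<Gamma> \<and> elements \<Gamma> \<noteq> {} \<and>
     (\<forall>k. 2 \<le> k \<and> k < n \<longrightarrow> \<not> (\<exists>\<Delta>. subgeometry \<Delta> \<Gamma> \<and> ordinary_polygon k \<Delta>)) \<and>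
     (\<forall>x\<in>elements \<Gamma>. \<forall>y\<in>elements \<Gamma>.
        \<exists>\<Delta>. subgeometry \<Delta> \<Gamma> \<and> ordinary_polygon n \<Delta> \<and> x \<in> elements \<Delta> \<and> y \<in> elements \<Delta>)"

definition has_order :: "('p, 'l) geometry \<Rightarrow> nat \<Rightarrow> nat \<Rightarrow> bool" where
  "has_order \<Gamma> s t \<longleftrightarrow>
     1 \<le> s \<and> 1 \<le> t \<and>
     (\<forall>l\<in>lines \<Gamma>. card {p. (p, l) \<in> inc \<Gamma>} = s + 1) \<and>
     (\<forall>p\<in>points \<Gamma>. card {l. (p, l) \<in> inc \<Gamma>} = t + 1)"

definition thick :: "('p, 'l) geometry \<Rightarrow> bool" where
  "thick \<Gamma> \<longleftrightarrow>
     (\<forall>p\<in>points \<Gamma>. infinite {l. (p, l) \<in> inc \<Gamma>} \<or> 3 \<le> card {l. (p, l) \<in> inc \<Gamma>}) \<and>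
     (\<forall>l\<in>lines \<Gamma>. infinite {p. (p, l) \<in> inc \<Gamma>} \<or> 3 \<le> card {p. (p, l) \<in> inc \<Gamma>})"

definition generalised_polygon :: "nat \<Rightarrow> ('p, 'l) geometry \<Rightarrow> bool" where
  "generalised_polygon n \<Gamma> \<longleftrightarrow> weak_generalised_polygon n \<Gamma> \<and> thick \<Gamma>"

definition opposite :: "nat \<Rightarrow> ('p, 'l) geometry \<Rightarrow> 'p + 'l \<Rightarrow> 'p + 'l \<Rightarrow> bool" where
  "opposite n \<Gamma> x y \<longleftrightarrow> x \<in> elements \<Gamma> \<and> y \<in> elements \<Gamma> \<and> distance \<Gamma> x y = enat n"

text \<open>\<open>trace_set m \<Gamma> d x y\<close> is the set \<open>T\<close> with indices \<open>d, x, y\<close> in a \<open>2m\<close>-gon;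
  \<open>is_distance_trace\<close> adds the side conditions under which it is called a distance \<open>d\<close>-trace.\<close>

definition trace_set :: "nat \<Rightarrow> ('p, 'l) geometry \<Rightarrow> nat \<Rightarrow> 'p + 'l \<Rightarrow> 'p + 'l \<Rightarrow> 'p set" where
  "trace_set m \<Gamma> d x y = points_at \<Gamma> d x \<inter> points_at \<Gamma> (2 * m - d) y"

definition is_distance_trace ::
    "nat \<Rightarrow> ('p, 'l) geometry \<Rightarrow> nat \<Rightarrow> 'p + 'l \<Rightarrow> 'p + 'l \<Rightarrow> 'p set \<Rightarrow> bool" where
  "is_distance_trace m \<Gamma> d x y T \<longleftrightarrow>
     d \<in> {1..m} \<and> opposite (2 * m) \<Gamma> x y \<and> T = trace_set m \<Gamma> d x y \<and> T \<noteq> {}"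


section \<open>Codes\<close>

text \<open>A function on the point set is represented by its extension by zero to the whole type;
  all indicator functions of point sets, and hence all code words, have this form.\<close>

global_interpretation fun_space: vector_space "\<lambda>(a :: 'f::field) (f :: 'p \<Rightarrow> 'f) x. a * f x"
  by unfold_locales (auto simp: fun_eq_iff algebra_simps)

definition line_indicator :: "('p, 'l) geometry \<Rightarrow> 'l \<Rightarrow> 'p \<Rightarrow> 'f::field" where
  "line_indicator \<Gamma> l = indicator (points_at \<Gamma> 1 (Inr l))"

definition code :: "('p, 'l) geometry \<Rightarrow> ('p \<Rightarrow> 'f::field) set" where
  "code \<Gamma> = fun_space.span (line_indicator \<Gamma> ` lines \<Gamma>)"

definition support :: "('p \<Rightarrow> 'f::field) \<Rightarrow> 'p set" where
  "support f = {x. f x \<noteq> 0}"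

definition weight :: "('p \<Rightarrow> 'f::field) \<Rightarrow> nat" where
  "weight f = card (support f)"

definition is_minimum_weight :: "('p \<Rightarrow> 'f::field) set \<Rightarrow> nat \<Rightarrow> bool" where
  "is_minimum_weight C w \<longleftrightarrow>
     (\<exists>c\<in>C. c \<noteq> 0 \<and> weight c = w) \<and> (\<forall>c\<in>C. c \<noteq> 0 \<longrightarrow> w \<le> weight c)"

definition minimum_weight_word :: "('p \<Rightarrow> 'f::field) set \<Rightarrow> ('p \<Rightarrow> 'f) \<Rightarrow> bool" where
  "minimum_weight_word C c \<longleftrightarrow> is_arg_min weight (\<lambda>c. c \<in> C \<and> c \<noteq> 0) c"

end

theory Submission
  imports Defs
begin

text \<open>Let \<open>\<delta>\<close> be the distance in the incidence graph, \<open>h(k) = \<Sum>j<k. (-s)^j\<close>, and give a point \<open>q\<close>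
  the weight \<open>h(m - \<delta>(p, q)/2)\<close> with respect to a point \<open>p\<close>. Every line has total weight \<open>1\<close>, so
  the weighted sum \<open>\<kappa>\<close> of a code word \<open>c\<close> does not depend on \<open>p\<close>. Walking away from a point of
  the support \<open>S\<close> one reaches, if \<open>|S| \<le> s + 1\<close>, a point \<open>p\<close> opposite all but exactly one point of
  \<open>S\<close>; as \<open>h\<close> does not vanish on \<open>{1..m}\<close>, this gives \<open>\<kappa> \<noteq> 0\<close>. Hence no point is opposite all of
  \<open>S\<close>, whereas any \<open>s\<close> points admit a common opposite point; so \<open>|S| = s + 1\<close>.

  Suppose now that \<open>|S| = s + 1\<close> and no point is opposite all of \<open>S\<close>. If two points of \<open>S\<close> have the
  same distance \<open>D\<close> to an element \<open>e\<close> and none is nearer, then walking away from \<open>e\<close> shows that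
  every branch at \<open>e\<close> contains a point of \<open>S\<close> at distance \<open>D\<close>, so all of \<open>S\<close> has distance \<open>D\<close>
  to \<open>e\<close>, and \<open>s = t\<close> if \<open>e\<close> is a point. Apply this to the middle element \<open>x\<close> of a geodesic between
  two points of \<open>S\<close> at minimal distance \<open>2d\<close>, and to the element \<open>y\<close> opposite \<open>x\<close> in an ordinary
  polygon through that geodesic: \<open>S\<close> is the distance \<open>d\<close>-trace of \<open>x\<close> and \<open>y\<close>.\<close>

section \<open>Distances in weak generalised polygons\<close>

lemma incidence_graph_sym: "sym (incidence_graph \<Gamma>)"
  by (auto simp: incidence_graph_def sym_def)

lemma incidence_graph_bipartite: "(x, y) \<in> incidence_graph \<Gamma> \<Longrightarrow> isl x \<noteq> isl y"
  by (auto simp: incidence_graph_def)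

lemma incidence_graph_Inl_Inr [simp]:
  "(Inl p, Inr l) \<in> incidence_graph \<Gamma> \<longleftrightarrow> (p, l) \<in> inc \<Gamma>"
  "(Inr l, Inl p) \<in> incidence_graph \<Gamma> \<longleftrightarrow> (p, l) \<in> inc \<Gamma>"
  by (auto simp: incidence_graph_def)

lemma Inl_Inr_in_elements [simp]:
  "Inl p \<in> elements \<Gamma> \<longleftrightarrow> p \<in> points \<Gamma>"
  "Inr l \<in> elements \<Gamma> \<longleftrightarrow> l \<in> lines \<Gamma>"
  by (auto simp: elements_def)

lemma sym_relpow: "sym R \<Longrightarrow> sym (R ^^ k)"
proof (induction k)
  case (Suc k)
  show ?case
  proof (rule symI)
    fix x y assume "(x, y) \<in> R ^^ Suc k"
    then obtain z where "(x, z) \<in> R ^^ k" "(z, y) \<in> R" by auto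
    then show "(y, x) \<in> R ^^ Suc k"
      using Suc by (meson relpow_Suc_I2 symD)
  qed
qed (auto simp: sym_def)

lemma walk_relpow:
  assumes "\<And>i. i < k \<Longrightarrow> (a (i0 + i), a (Suc (i0 + i))) \<in> R"
  shows "(a i0, a (i0 + k)) \<in> R ^^ k"
  using assms by (induction k) auto

section \<open>Chordless circuits as ordinary polygons\<close>

lemma mod_Suc_cong_iff: "Suc i mod K = Suc j mod K \<longleftrightarrow> i mod K = j mod K" for K :: nat
  by (simp only: nat_mod_eq_iff) simp

text \<open>The cycle is indexed periodically by all natural numbers, so that it may be assumed
  to start at a point by shifting it.\<close>

lemma chordless_cycle_ordinary_polygon:
  fixes c :: "nat \<Rightarrow> 'p + 'l"
  assumes k: "2 \<le> k" and geom: "point_line_geometry \<Gamma>"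
    and edge: "\<And>i. (c i, c (Suc i)) \<in> incidence_graph \<Gamma>"
    and inj: "\<And>i j. c i = c j \<longleftrightarrow> i mod (2 * k) = j mod (2 * k)"
    and chordless: "\<And>i j. (c i, c j) \<in> incidence_graph \<Gamma> \<Longrightarrow>
      j mod (2 * k) = Suc i mod (2 * k) \<or> i mod (2 * k) = Suc j mod (2 * k)"
  shows "\<exists>\<Delta>. subgeometry \<Delta> \<Gamma> \<and> ordinary_polygon k \<Delta>"
proof -
  have main: "\<exists>\<Delta>. subgeometry \<Delta> \<Gamma> \<and> ordinary_polygon k \<Delta>"
    if isl0: "isl (c 0)"
      and edge: "\<And>i. (c i, c (Suc i)) \<in> incidence_graph \<Gamma>"
      and inj: "\<And>i j. c i = c j \<longleftrightarrow> i mod (2 * k) = j mod (2 * k)"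
      and chordless: "\<And>i j. (c i, c j) \<in> incidence_graph \<Gamma> \<Longrightarrow>
        j mod (2 * k) = Suc i mod (2 * k) \<or> i mod (2 * k) = Suc j mod (2 * k)"
    for c :: "nat \<Rightarrow> 'p + 'l"
  proof -
    have isl: "isl (c i) \<longleftrightarrow> even i" for i
    proof (induction i)
      case (Suc i)
      then show ?case using incidence_graph_bipartite[OF edge[of i]] by auto
    qed (simp add: isl0)
    define p where "p i = projl (c (2 * i))" for i
    define l where "l i = projr (c (2 * i + 1))" for i
    have cp: "c (2 * i) = Inl (p i)" for i
      using isl[of "2 * i"] by (auto simp: p_def isl_def)
    have cl: "c (Suc (2 * i)) = Inr (l i)" for i
      using isl[of "2 * i + 1"] by (cases "c (2 * i + 1)") (auto simp: l_def)
    have modk: "2 * i mod (2 * k) = 2 * (i mod k)" for i by simp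
    have modk1: "Suc (2 * i) mod (2 * k) = Suc (2 * (i mod k))" for i
    proof -
      \<comment> \<open>By parity the successor of an even residue is never 2k, so the reduction
        does not wrap around.\<close>
      have "Suc (2 * (i mod k)) \<noteq> 2 * k" by (metis even_Suc dvd_triv_left)
      then show ?thesis by (simp add: mod_Suc)
    qed
    have p_eq: "p i = p j \<longleftrightarrow> i mod k = j mod k" for i j
    proof -
      have "p i = p j \<longleftrightarrow> c (2 * i) = c (2 * j)" by (simp add: cp)
      then show ?thesis by (simp add: inj modk)
    qed
    have l_eq: "l i = l j \<longleftrightarrow> i mod k = j mod k" for i j
    proof -
      have "l i = l j \<longleftrightarrow> c (Suc (2 * i)) = c (Suc (2 * j))" by (simp add: cl)
      then show ?thesis unfolding inj modk1 by simp
    qed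
    have inc1: "(p i, l i) \<in> inc \<Gamma>" for i
      using edge[of "2 * i"] by (simp add: cp cl)
    have inc2: "(p (Suc i), l i) \<in> inc \<Gamma>" for i
      using edge[of "Suc (2 * i)"] cp[of "Suc i"] by (simp add: cl)
    have inc_iff: "(p i, l j) \<in> inc \<Gamma> \<longleftrightarrow> i mod k = j mod k \<or> i mod k = Suc j mod k" for i j
    proof
      assume "(p i, l j) \<in> inc \<Gamma>"
      then have "(c (2 * i), c (Suc (2 * j))) \<in> incidence_graph \<Gamma>" by (simp add: cp cl)
      from chordless[OF this]
      have "Suc (2 * j) mod (2 * k) = Suc (2 * i) mod (2 * k) \<or>
        2 * i mod (2 * k) = 2 * Suc j mod (2 * k)" by simp
      then show "i mod k = j mod k \<or> i mod k = Suc j mod k"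
        unfolding modk modk1 by auto
    next
      assume "i mod k = j mod k \<or> i mod k = Suc j mod k"
      then have "p i = p j \<or> p i = p (Suc j)" using p_eq by simp
      then show "(p i, l j) \<in> inc \<Gamma>" using inc1[of j] inc2[of j] by auto
    qed
    \<comment> \<open>Taking the induced incidence makes \<Delta> a subgeometry at once; that no
      further incidences occur is \<open>inc_iff\<close>, which rests on chordlessness.\<close>
    define \<Delta> where "\<Delta> = \<lparr>points = p ` {..<k}, lines = l ` {..<k},
      inc = inc \<Gamma> \<inter> (p ` {..<k} \<times> l ` {..<k})\<rparr>"
    have "subgeometry \<Delta> \<Gamma>"
      using geom inc1 by (auto simp: subgeometry_def \<Delta>_def point_line_geometry_def)
    moreover have "ordinary_polygon k \<Delta>"
      unfolding ordinary_polygon_def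
    proof (intro conjI exI)
      show "bij_betw p {..<k} (points \<Delta>)" "bij_betw l {..<k} (lines \<Delta>)"
        by (auto simp: bij_betw_def \<Delta>_def inj_on_def p_eq l_eq)
      have pmod: "p (Suc i mod k) = p (Suc i)" for i by (simp add: p_eq)
      show "inc \<Delta> = (\<Union>i<k. {(p i, l i), (p (Suc i mod k), l i)})" (is "_ = ?R")
      proof (rule set_eqI, rule iffI)
        fix e assume "e \<in> inc \<Delta>"
        then obtain i j where e: "e = (p i, l j)" "i < k" "j < k" "(p i, l j) \<in> inc \<Gamma>"
          by (auto simp: \<Delta>_def)
        then have "i = j \<or> i = Suc j mod k" using inc_iff[of i j] by simp
        then show "e \<in> ?R" using e by auto
      next
        fix e assume "e \<in> ?R"
        then obtain i where "i < k" "e = (p i, l i) \<or> e = (p (Suc i mod k), l i)" by auto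
        moreover from this have "Suc i mod k < k" by simp
        ultimately show "e \<in> inc \<Delta>"
          using inc1[of i] inc2[of i] unfolding pmod[symmetric] by (auto simp: \<Delta>_def)
      qed
    qed (fact k)
    ultimately show ?thesis by blast
  qed
  show ?thesis
  proof (cases "isl (c 0)")
    case True
    then show ?thesis using main[of c] edge inj chordless by blast
  next
    case False
    then have "isl (c (Suc 0))" using incidence_graph_bipartite[OF edge[of 0]] by simp
    then show ?thesis
      using main[of "\<lambda>i. c (Suc i)"] edge inj[of "Suc _" "Suc _"] chordless[of "Suc _" "Suc _"]
      unfolding mod_Suc_cong_iff by blast
  qed
qed

text \<open>A natural number avoids extended arithmetic. For unconnected elements the value is junk,
  but a weak polygon is connected and \<open>distance_eq_dist_nat\<close> applies.\<close>

definition dist_nat :: "('p, 'l) geometry \<Rightarrow> 'p + 'l \<Rightarrow> 'p + 'l \<Rightarrow> nat" where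
  "dist_nat \<Gamma> x y = (LEAST k. (x, y) \<in> incidence_graph \<Gamma> ^^ k)"

section \<open>The metric of the incidence graph of a weak polygon\<close>

locale weak_polygon =
  fixes \<Gamma> :: "('p, 'l) geometry" and n :: nat
  assumes weak_polygon: "weak_generalised_polygon n \<Gamma>"
begin

abbreviation "G \<equiv> incidence_graph \<Gamma>"
abbreviation "V \<equiv> elements \<Gamma>"
abbreviation "\<delta> \<equiv> dist_nat \<Gamma>"

lemma n_ge: "3 \<le> n" and geom: "point_line_geometry \<Gamma>"
  using weak_polygon by (auto simp: weak_generalised_polygon_def)

lemma edge_in_elements:
  assumes "(x, y) \<in> G"
  shows "x \<in> V" "y \<in> V"
  using assms geom by (auto simp: incidence_graph_def point_line_geometry_def)

lemma edge_sym: "(x, y) \<in> G \<Longrightarrow> (y, x) \<in> G"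
  using incidence_graph_sym by (rule symD)

text \<open>The two elements lie on a common ordinary n-gon, a circuit of length 2n in the incidence
  graph, and one of its arcs between them has length at most n.\<close>

lemma relpow_diameter:
  assumes "x \<in> V" "y \<in> V"
  shows "\<exists>k\<le>n. (x, y) \<in> G ^^ k"
proof -
  obtain \<Delta> where \<Delta>: "subgeometry \<Delta> \<Gamma>" "ordinary_polygon n \<Delta>" "x \<in> elements \<Delta>" "y \<in> elements \<Delta>"
    using weak_polygon assms unfolding weak_generalised_polygon_def by blast
  obtain p l where pl: "bij_betw p {..<n} (points \<Delta>)" "bij_betw l {..<n} (lines \<Delta>)"
    "inc \<Delta> = (\<Union>i<n. {(p i, l i), (p (Suc i mod n), l i)})"
    using \<Delta>(2) unfolding ordinary_polygon_def by blast
  \<comment> \<open>The circuit, with points at even and lines at odd indices, continued with period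
    2n.\<close>
  define c where "c i = (if even i then Inl (p (i div 2 mod n)) else Inr (l (i div 2 mod n)))" for i
  have n: "0 < n" using n_ge by simp
  have inc1: "(p (i mod n), l (i mod n)) \<in> inc \<Gamma>" "(p (Suc i mod n), l (i mod n)) \<in> inc \<Gamma>" for i
  proof -
    have "(p (i mod n), l (i mod n)) \<in> inc \<Delta>" "(p (Suc (i mod n) mod n), l (i mod n)) \<in> inc \<Delta>"
      unfolding pl(3) using n by auto
    then show "(p (i mod n), l (i mod n)) \<in> inc \<Gamma>" "(p (Suc i mod n), l (i mod n)) \<in> inc \<Gamma>"
      using \<Delta>(1) by (auto simp: subgeometry_def mod_Suc_eq)
  qed
  have edge: "(c i, c (Suc i)) \<in> G" for i
  proof (cases "even i")
    case True
    then show ?thesis using inc1(1)[of "i div 2"] by (simp add: c_def)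
  next
    case False
    then have "Suc i div 2 = Suc (i div 2)" by presburger
    then show ?thesis using inc1(2)[of "i div 2"] False by (simp add: c_def)
  qed
  have walk: "(c i, c (i + j)) \<in> G ^^ j" for i j
    by (rule walk_relpow) (rule edge)
  have period: "c (i + 2 * n) = c i" for i
    by (simp add: c_def)
  have cover: "\<exists>i<2 * n. c i = z" if "z \<in> elements \<Delta>" for z
  proof (cases z)
    case (Inl q)
    then have "q \<in> p ` {..<n}" using that bij_betw_imp_surj_on[OF pl(1)] by simp
    then obtain i where "i < n" "q = p i" by auto
    then show ?thesis using Inl by (intro exI[of _ "2 * i"]) (simp add: c_def)
  next
    case (Inr q)
    then have "q \<in> l ` {..<n}" using that bij_betw_imp_surj_on[OF pl(2)] by simp
    then obtain i where "i < n" "q = l i" by auto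
    then show ?thesis using Inr by (intro exI[of _ "2 * i + 1"]) (simp add: c_def)
  qed
  have main: "\<exists>k\<le>n. (c i, c j) \<in> G ^^ k" if "i \<le> j" "j < 2 * n" for i j
  proof (cases "j - i \<le> n")
    case True
    then show ?thesis using walk[of i "j - i"] that by auto
  next
    case False
    \<comment> \<open>The complementary arc, which passes the end of the period.\<close>
    have "(c j, c (i + 2 * n)) \<in> G ^^ (i + 2 * n - j)"
      using walk[of j "i + 2 * n - j"] that by simp
    then have "(c i, c j) \<in> G ^^ (i + 2 * n - j)"
      unfolding period using sym_relpow[OF incidence_graph_sym] by (blast dest: symD)
    then show ?thesis using False by (intro exI[of _ "i + 2 * n - j"]) simp
  qed
  obtain i j where "i < 2 * n" "j < 2 * n" "c i = x" "c j = y"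
    using cover \<Delta>(3,4) by blast
  then show ?thesis
    using main[of i j] main[of j i] sym_relpow[OF incidence_graph_sym]
    by (metis nat_le_linear symD)
qed

lemma dist_walk: "x \<in> V \<Longrightarrow> y \<in> V \<Longrightarrow> (x, y) \<in> G ^^ \<delta> x y"
  unfolding dist_nat_def using relpow_diameter by (metis LeastI)

lemma dist_le_walk: "(x, y) \<in> G ^^ k \<Longrightarrow> \<delta> x y \<le> k"
  unfolding dist_nat_def by (rule Least_le)

lemma dist_le_n: "x \<in> V \<Longrightarrow> y \<in> V \<Longrightarrow> \<delta> x y \<le> n"
  using relpow_diameter dist_le_walk le_trans by blast

lemma distance_eq_dist_nat:
  assumes "x \<in> V" "y \<in> V"
  shows "distance \<Gamma> x y = enat (\<delta> x y)"
  unfolding distance_def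
proof (rule antisym)
  show "(INF k\<in>{k. (x, y) \<in> G ^^ k}. enat k) \<le> enat (\<delta> x y)"
    using dist_walk[OF assms] by (intro INF_lower) simp
  show "enat (\<delta> x y) \<le> (INF k\<in>{k. (x, y) \<in> G ^^ k}. enat k)"
    by (intro INF_greatest) (simp add: dist_le_walk)
qed

lemma dist_sym: "\<delta> x y = \<delta> y x"
  unfolding dist_nat_def using sym_relpow[OF incidence_graph_sym] by (metis symD)

lemma dist_triangle:
  assumes "x \<in> V" "y \<in> V" "z \<in> V"
  shows "\<delta> x z \<le> \<delta> x y + \<delta> y z"
proof -
  have "(x, z) \<in> G ^^ \<delta> x y O G ^^ \<delta> y z" using dist_walk assms by blast
  then show ?thesis by (intro dist_le_walk) (simp add: relpow_add)
qed

lemma dist_self [simp]: "\<delta> x x = 0"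
  using dist_le_walk[of x x 0] by simp

lemma dist_eq_0: "x \<in> V \<Longrightarrow> y \<in> V \<Longrightarrow> \<delta> x y = 0 \<longleftrightarrow> x = y"
  using dist_walk[of x y] by auto

lemma walk_parity: "(x, y) \<in> G ^^ k \<Longrightarrow> even k \<longleftrightarrow> isl x = isl y"
proof (induction k arbitrary: y)
  case (Suc k)
  then obtain z where "(x, z) \<in> G ^^ k" "(z, y) \<in> G" by auto
  then show ?case using Suc.IH[of z] incidence_graph_bipartite[of z y] by auto
qed auto

lemma dist_parity: "x \<in> V \<Longrightarrow> y \<in> V \<Longrightarrow> even (\<delta> x y) \<longleftrightarrow> isl x = isl y"
  using walk_parity[OF dist_walk] .

lemma dist_edge: "(x, y) \<in> G \<Longrightarrow> \<delta> x y = 1"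
  using dist_le_walk[of x y 1] dist_eq_0[of x y] edge_in_elements[of x y]
    incidence_graph_bipartite[of x y] by (cases "\<delta> x y") auto

lemma dist_1_edge: "x \<in> V \<Longrightarrow> y \<in> V \<Longrightarrow> \<delta> x y = 1 \<Longrightarrow> (x, y) \<in> G"
  using dist_walk[of x y] by auto

text \<open>Adjacent elements lie in different parts of the bipartition, so parity excludes equal
  distances to z.\<close>

lemma dist_neighbour:
  assumes "(x, y) \<in> G" "z \<in> V"
  shows "\<delta> y z = Suc (\<delta> x z) \<or> \<delta> x z = Suc (\<delta> y z)"
proof -
  note V = edge_in_elements[OF assms(1)]
  have "\<delta> y z \<le> \<delta> x z + 1" "\<delta> x z \<le> \<delta> y z + 1"
    using dist_triangle[OF V(2,1) assms(2)] dist_triangle[OF V assms(2)]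
      dist_edge[OF assms(1)] dist_sym[of y x] by auto
  moreover have "\<delta> y z \<noteq> \<delta> x z"
    using dist_parity[OF V(1) assms(2)] dist_parity[OF V(2) assms(2)]
      incidence_graph_bipartite[OF assms(1)] by auto
  ultimately show ?thesis by linarith
qed

lemma geodesic_between:
  assumes "x \<in> V" "y \<in> V" "\<delta> x y = i + j"
  obtains z where "z \<in> V" "\<delta> x z = i" "\<delta> z y = j"
proof -
  have "(x, y) \<in> G ^^ i O G ^^ j"
    using dist_walk[OF assms(1,2)] assms(3) by (simp add: relpow_add)
  then obtain z where z: "(x, z) \<in> G ^^ i" "(z, y) \<in> G ^^ j" by auto
  have zV: "z \<in> V"
    using z assms(1) by (cases i) (auto dest: edge_in_elements)
  show ?thesis
    using that[OF zV] dist_le_walk[OF z(1)] dist_le_walk[OF z(2)]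
      dist_triangle[OF assms(1) zV assms(2)] assms(3) by linarith
qed

text \<open>Two such sequences with different second elements z become the sides of the circuit in
  \<open>projection_unique\<close>.\<close>

lemma geodesic_sequence:
  assumes "(x, z) \<in> G" "y \<in> V" "\<delta> x y = k" "Suc (\<delta> z y) = k"
  obtains a where "a 0 = x" "a 1 = z" "a k = y" "\<And>i. i \<le> k \<Longrightarrow> a i \<in> V"
    "\<And>i. i < k \<Longrightarrow> (a i, a (Suc i)) \<in> G"
    "\<And>i j. i \<le> j \<Longrightarrow> j \<le> k \<Longrightarrow> \<delta> (a i) (a j) = j - i"
proof -
  note V = edge_in_elements[OF assms(1)]
  obtain f where f: "f 0 = z" "f (\<delta> z y) = y" "\<And>i. i < \<delta> z y \<Longrightarrow> (f i, f (Suc i)) \<in> G"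
    using dist_walk[OF V(2) assms(2)] unfolding relpow_fun_conv by blast
  define a where "a i = (case i of 0 \<Rightarrow> x | Suc i \<Rightarrow> f i)" for i
  have a: "a 0 = x" "a 1 = z" "a k = y"
    using f assms(4) by (auto simp: a_def)
  have edge: "(a i, a (Suc i)) \<in> G" if "i < k" for i
    using that f assms by (cases i) (auto simp: a_def)
  have aV: "a i \<in> V" if "i \<le> k" for i
    using that a(1) V(1) edge_in_elements(2)[OF edge[of "i - 1"]] by (cases i) simp_all
  have le: "\<delta> (a i) (a j) \<le> j - i" if "i \<le> j" "j \<le> k" for i j
    using dist_le_walk[OF walk_relpow[where ?i0.0 = i and k = "j - i" and a = a and R = G]]
      that edge by auto
  have "\<delta> (a i) (a j) = j - i" if ij: "i \<le> j" "j \<le> k" for i j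
  proof -
    have "k \<le> \<delta> (a 0) (a i) + \<delta> (a i) (a k)"
      using dist_triangle[of "a 0" "a i" "a k"] aV a ij assms by auto
    moreover have "\<delta> (a i) (a k) \<le> \<delta> (a i) (a j) + \<delta> (a j) (a k)"
      using dist_triangle aV ij by auto
    ultimately show ?thesis using le[of 0 i] le[of j k] le[of i j] ij by linarith
  qed
  with that a aV edge show ?thesis by blast
qed

text \<open>Two geodesics between elements at minimal distance violating uniqueness form a chordless
  circuit, that is, an ordinary polygon.\<close>

lemma projection_unique:
  assumes "(x, z) \<in> G" "(x, z') \<in> G" "y \<in> V" "\<delta> x y < n"
    and "\<delta> x y = Suc (\<delta> z y)" "\<delta> x y = Suc (\<delta> z' y)"
  shows "z = z'"
proof -
  have "z = z'"
    if "k < n" "(x, z) \<in> G" "(x, z') \<in> G" "y \<in> V" "\<delta> x y = k" "Suc (\<delta> z y) = k" "Suc (\<delta> z' y) = k"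
    for k x y z z'
    using that
  proof (induction k arbitrary: x y z z' rule: less_induct)
    case (less k)
    show ?case
    proof (rule ccontr)
      assume ne: "z \<noteq> z'"
      obtain a where a: "a 0 = x" "a 1 = z" "a k = y" "\<And>i. i \<le> k \<Longrightarrow> a i \<in> V"
        "\<And>i. i < k \<Longrightarrow> (a i, a (Suc i)) \<in> G"
        "\<And>i j. i \<le> j \<Longrightarrow> j \<le> k \<Longrightarrow> \<delta> (a i) (a j) = j - i"
        using geodesic_sequence[OF less.prems(2,4,5,6)] by blast
      obtain b where b: "b 0 = x" "b 1 = z'" "b k = y" "\<And>i. i \<le> k \<Longrightarrow> b i \<in> V"
        "\<And>i. i < k \<Longrightarrow> (b i, b (Suc i)) \<in> G"
        "\<And>i j. i \<le> j \<Longrightarrow> j \<le> k \<Longrightarrow> \<delta> (b i) (b j) = j - i"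
        using geodesic_sequence[OF less.prems(3,4,5,7)] by blast
      have k: "2 \<le> k"
        proof -
        have "k \<noteq> 1" using a(2,3) b(2,3) ne by metis
        then show ?thesis using less.prems(6) by linarith
      qed
      have ya: "\<delta> (a i) y = k - i" and yb: "\<delta> (b i) y = k - i" if "i \<le> k" for i
        using a(3) a(6)[of i k] b(3) b(6)[of i k] that by auto
      \<comment> \<open>A common element at an inner level would give z = z' by the induction
        hypothesis with that element in place of y.\<close>
      have ab: "i = j \<and> (i = 0 \<or> i = k)" if "i \<le> k" "j \<le> k" "a i = b j" for i j
      proof -
        have ij: "i = j" using ya[of i] yb[of j] that by simp
        have False if i: "0 < i" "i < k"
        proof -
          have "\<delta> x (a i) = i" using a(1) a(6)[of 0 i] i by simp
          moreover have "Suc (\<delta> z (a i)) = i" using a(2) a(6)[of 1 i] i by simp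
          moreover have "Suc (\<delta> z' (a i)) = i"
            using b(2) b(6)[of 1 i] i \<open>a i = b j\<close> ij by simp
          moreover have "a i \<in> V" using a(4) i by simp
          ultimately show False
            using less.IH[of i x z z' "a i"] less.prems i ne by simp
        qed
        then show ?thesis using ij that(1) by (metis le_neq_implies_less not_gr_zero)
      qed
      have level: "j = Suc i \<or> i = Suc j"
        if "(u, v) \<in> G" "\<delta> u y = k - i" "\<delta> v y = k - j" "i \<le> k" "j \<le> k" for u v i j
        using dist_neighbour[OF that(1) less.prems(4)] that by linarith
      \<comment> \<open>Away from the ends, a chord between levels i and i + 1 gives one element two
        neighbours nearer to y. The induction hypothesis identifies them, but inner levels are
        disjoint.\<close>
      have chord: "i = 0 \<or> Suc i = k" if "i < k" "(a i, b (Suc i)) \<in> G \<or> (b i, a (Suc i)) \<in> G" for i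
      proof (rule ccontr)
        assume "\<not> (i = 0 \<or> Suc i = k)"
        then have i: "0 < i" "Suc i < k" using that by auto
        have "a (Suc i) = b (Suc i)"
          using that(2)
        proof
          assume *: "(a i, b (Suc i)) \<in> G"
          show ?thesis
            using less.IH[of "k - i" "a i" "a (Suc i)" "b (Suc i)" y] * a(5)[of i] i
              less.prems(1,4) ya[of i] ya[of "Suc i"] yb[of "Suc i"] by simp
        next
          assume *: "(b i, a (Suc i)) \<in> G"
          show ?thesis
            using less.IH[of "k - i" "b i" "a (Suc i)" "b (Suc i)" y] * b(5)[of i] i
              less.prems(1,4) yb[of i] ya[of "Suc i"] yb[of "Suc i"] by simp
        qed
        then show False using ab[of "Suc i" "Suc i"] i by simp
      qed
      define K where "K = 2 * k"
      have K: "k < K" "0 < K" using k by (auto simp: K_def)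
      \<comment> \<open>Along \<open>a\<close> from x to y and back along \<open>b\<close> to x;
        \<open>c\<close> repeats this circuit of length 2k.\<close>
      define e where "e i = (if i \<le> k then a i else b (K - i))" for i
      define c where "c i = e (i mod K)" for i
      have e_b: "e i = b (K - i)" if "k \<le> i" for i
        using that a(3) b(3) by (cases "i = k") (auto simp: e_def K_def)
      have e_K: "e K = e 0" using e_b[of K] K by (simp add: e_def a b)
      have edge_e: "(e i, e (Suc i)) \<in> G" if "i < K" for i
      proof (cases "i < k")
        case True
        then show ?thesis using a(5)[of i] by (simp add: e_def)
      next
        case False
        then have "(b (K - Suc i), b (Suc (K - Suc i))) \<in> G"
          using b(5)[of "K - Suc i"] that by (simp add: K_def)
        then show ?thesis
          using False that edge_sym by (simp add: e_b Suc_diff_Suc)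
      qed
      have edge: "(c i, c (Suc i)) \<in> G" for i
      proof -
        have "c (Suc i) = e (Suc (i mod K))"
          using e_K by (simp add: c_def mod_Suc)
        then show ?thesis using edge_e[of "i mod K"] K by (simp add: c_def)
      qed
      have e_inj: "i = j" if "i < K" "j < K" "e i = e j" "i \<le> j" for i j
      proof -
        consider "j \<le> k" | "k < i" | "i \<le> k" "k < j" by linarith
        then show ?thesis
        proof cases
          case 1
          then show ?thesis using that a(6)[of i j] by (simp add: e_def)
        next
          case 2
          then have "\<delta> (b (K - j)) (b (K - i)) = j - i"
            using b(6)[of "K - j" "K - i"] that by (simp add: K_def)
          then show ?thesis using that 2 by (simp add: e_def)
        next
          case 3
          then show ?thesis using that ab[of i "K - j"] by (auto simp: e_def K_def)
        qed
      qed
      have inj: "c i = c j \<longleftrightarrow> i mod K = j mod K" for i j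
        using e_inj[of "i mod K" "j mod K"] e_inj[of "j mod K" "i mod K"] K
        unfolding c_def by (metis mod_less_divisor nat_le_linear)
      have e_chordless: "j = Suc i \<or> i = 0 \<and> Suc j = K"
        if ij: "i < K" "j < K" "i \<le> j" and E: "(e i, e j) \<in> G" for i j
      proof -
        consider "j \<le> k" | "k < i" | "i \<le> k" "k < j" by linarith
        then show ?thesis
        proof cases
          case 1
          then show ?thesis
            using level[OF E, of i j] ya[of i] ya[of j] ij by (auto simp: e_def)
        next
          case 2
          then have le: "K - i \<le> k" "K - j \<le> k" using ij by (auto simp: K_def)
          have "K - j = Suc (K - i) \<or> K - i = Suc (K - j)"
            by (rule level[OF E]) (use 2 ij le yb in \<open>auto simp: e_def\<close>)
          then show ?thesis using ij by linarith
        next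
          case 3
          define j' where "j' = K - j"
          have j': "j' < k" "0 < j'" "j = K - j'" using 3 ij by (auto simp: j'_def K_def)
          have E': "(a i, b j') \<in> G" using E 3 by (simp add: e_def j'_def)
          have "j' = Suc i \<or> i = Suc j'"
            using level[OF E', of i j'] ya[of i] yb[of j'] 3 j' by simp
          then show ?thesis
          proof
            assume "j' = Suc i"
            then show ?thesis using chord[of i] E' j' by (auto simp: K_def)
          next
            assume i: "i = Suc j'"
            then have "(b j', a (Suc j')) \<in> G" using E' edge_sym by simp
            then show ?thesis using chord[of j'] i j' by (auto simp: K_def)
          qed
        qed
      qed
      have chordless: "j mod K = Suc i mod K \<or> i mod K = Suc j mod K" if "(c i, c j) \<in> G" for i j
      proof -
        have S: "Suc i mod K = (if Suc (i mod K) = K then 0 else Suc (i mod K))" for i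
          by (simp add: mod_Suc)
        show ?thesis
          using e_chordless[of "i mod K" "j mod K"] e_chordless[of "j mod K" "i mod K"]
            that edge_sym[OF that] K S[of i] S[of j]
          unfolding c_def
          by (metis mod_less_divisor nat_le_linear less_irrefl)
      qed
      have "\<exists>\<Delta>. subgeometry \<Delta> \<Gamma> \<and> ordinary_polygon k \<Delta>"
        using chordless_cycle_ordinary_polygon[where c = c, OF k geom edge inj[unfolded K_def]
            chordless[unfolded K_def]] .
      then show False
        using weak_polygon k less.prems(1) unfolding weak_generalised_polygon_def by blast
    qed
  qed
  from this[OF assms(4,1,2,3) refl assms(5)[symmetric] assms(6)[symmetric]] show ?thesis .
qed

text \<open>As long as y is not opposite x, at most one neighbour of y is nearer to x, and y has at
  least two neighbours.\<close>

lemma dist_extend: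
  assumes "x \<in> V" "y \<in> V" "\<delta> x y < n" "\<And>z. \<exists>y'. (y, y') \<in> G \<and> y' \<noteq> z"
  shows "\<exists>y'. (y, y') \<in> G \<and> \<delta> x y' = Suc (\<delta> x y)"
proof (rule ccontr)
  assume no: "\<not> ?thesis"
  have pred: "\<delta> y x = Suc (\<delta> y' x)" if "(y, y') \<in> G" for y'
    using dist_neighbour[OF that assms(1)] that no dist_sym[of x y] dist_sym[of x y'] by auto
  obtain y1 where y1: "(y, y1) \<in> G" using assms(4) by blast
  obtain y2 where y2: "(y, y2) \<in> G" "y2 \<noteq> y1" using assms(4) by blast
  show False
    using projection_unique[OF y1 y2(1) assms(1)] pred[OF y1] pred[OF y2(1)] y2(2) assms(3)
      dist_sym[of x y] by simp
qed

text \<open>A walk without backtracking of length at most \<open>n\<close> is a geodesic.\<close>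

lemma dist_concat:
  assumes "x \<in> V" "y \<in> V" "(w, u) \<in> G" "\<delta> x u = Suc (\<delta> x w)"
    and "\<delta> u y = j" "\<delta> w y = Suc j" "\<delta> x w + Suc j \<le> n"
  shows "\<delta> x y = \<delta> x w + Suc j"
  using assms
proof (induction j arbitrary: w u)
  case 0
  then show ?case using dist_eq_0[of u y] edge_in_elements by simp
next
  case (Suc j)
  note V = edge_in_elements[OF Suc.prems(3)]
  obtain v where v: "v \<in> V" "\<delta> u v = 1" "\<delta> v y = j"
    using geodesic_between[OF V(2) Suc.prems(2), of 1 j] Suc.prems(5) by auto
  have uv: "(u, v) \<in> G" using dist_1_edge V v by blast
  have "\<delta> x v = Suc (\<delta> x u)"
  proof (rule ccontr)
    assume "\<delta> x v \<noteq> Suc (\<delta> x u)"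
    then have "\<delta> u x = Suc (\<delta> v x)"
      using dist_neighbour[OF uv Suc.prems(1)] dist_sym[of x] by auto
    \<comment> \<open>Otherwise v and w both are the neighbour of u nearer to x; but v is nearer to
      y than u, and w is farther.\<close>
    then have "v = w"
      using projection_unique[OF uv edge_sym[OF Suc.prems(3)] Suc.prems(1)] Suc.prems(4,7)
        dist_sym[of x] by simp
    then show False using v(3) Suc.prems(6) by simp
  qed
  then show ?case
    using Suc.IH[OF Suc.prems(1,2) uv] v(3) Suc.prems by simp
qed

text \<open>The first steps from x towards u and v both lead nearer to y, so they agree by
  \<open>projection_unique\<close>; then induction on i.\<close>

lemma geodesic_unique:
  assumes "x \<in> V" "y \<in> V" "u \<in> V" "v \<in> V" "i + j < n" "\<delta> x y = i + j"
    and "\<delta> x u = i" "\<delta> x v = i" "\<delta> u y = j" "\<delta> v y = j"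
  shows "u = v"
  using assms
proof (induction i arbitrary: x)
  case 0
  then show ?case using dist_eq_0 by metis
next
  case (Suc i)
  have first: "\<exists>a. (x, a) \<in> G \<and> \<delta> a w = i \<and> \<delta> a y = i + j"
    if w: "w \<in> V" "\<delta> x w = Suc i" "\<delta> w y = j" for w
  proof -
    obtain a where a: "a \<in> V" "\<delta> x a = 1" "\<delta> a w = i"
      using geodesic_between[OF Suc.prems(1) w(1), of 1 i] w(2) by auto
    have xa: "(x, a) \<in> G" using dist_1_edge a Suc.prems(1) by blast
    have "\<delta> a y \<le> i + j" using dist_triangle[OF a(1) w(1) Suc.prems(2)] a w by simp
    then show ?thesis
      using dist_neighbour[OF xa Suc.prems(2)] Suc.prems(6) a xa by auto
  qed
  obtain a b where a: "(x, a) \<in> G" "\<delta> a u = i" "\<delta> a y = i + j"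
    and b: "(x, b) \<in> G" "\<delta> b v = i" "\<delta> b y = i + j"
    using first[OF Suc.prems(3,7,9)] first[OF Suc.prems(4,8,10)] by blast
  have "a = b"
    using projection_unique[OF a(1) b(1) Suc.prems(2)] a b Suc.prems(5,6) by simp
  then show ?case
    using Suc.IH[of a] a b Suc.prems edge_in_elements[OF a(1)] by simp
qed

end

text \<open>The counting device for what follows: injectivity of the relation always comes from the
  uniqueness of projections or of geodesics.\<close>

lemma card_le_if_injective_relation:
  assumes "finite B" "\<And>a. a \<in> A \<Longrightarrow> \<exists>b\<in>B. R a b"
    and "\<And>a a' b. a \<in> A \<Longrightarrow> a' \<in> A \<Longrightarrow> b \<in> B \<Longrightarrow> R a b \<Longrightarrow> R a' b \<Longrightarrow> a = a'"
  shows "card A \<le> card B"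
proof -
  obtain f where f: "\<And>a. a \<in> A \<Longrightarrow> f a \<in> B \<and> R a (f a)"
    using assms(2) by metis
  have "inj_on f A" using f assms(3) by (metis inj_onI)
  then show ?thesis using f assms(1) by (intro card_inj_on_le[of f]) auto
qed

section \<open>Finite 2m-gons with an order\<close>

locale even_polygon_order = weak_polygon \<Gamma> "2 * m" for \<Gamma> :: "('p, 'l) geometry" and m :: nat +
  fixes s t :: nat
  assumes order: "has_order \<Gamma> s t" and finite_geometry: "finite_geometry \<Gamma>"
    and s_le_t: "s \<le> t"
begin

abbreviation pdist :: "'p \<Rightarrow> 'p \<Rightarrow> nat" where
  "pdist p q \<equiv> \<delta> (Inl p) (Inl q)"

abbreviation ldist :: "'l \<Rightarrow> 'p \<Rightarrow> nat" where
  "ldist l q \<equiv> \<delta> (Inr l) (Inl q)"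

lemma s_pos: "1 \<le> s" and t_pos: "1 \<le> t"
  using order by (auto simp: has_order_def)

lemma finite_points: "finite (points \<Gamma>)"
  using finite_geometry by (simp add: finite_geometry_def)

lemma finite_point_set: "S \<subseteq> points \<Gamma> \<Longrightarrow> finite S"
  by (rule finite_subset[OF _ finite_points])

lemma inc_in_geometry:
  assumes "(p, l) \<in> inc \<Gamma>"
  shows "p \<in> points \<Gamma>" "l \<in> lines \<Gamma>"
  using assms geom by (auto simp: point_line_geometry_def)

lemma card_points_on: "l \<in> lines \<Gamma> \<Longrightarrow> card {p. (p, l) \<in> inc \<Gamma>} = s + 1"
  and card_lines_on: "p \<in> points \<Gamma> \<Longrightarrow> card {l. (p, l) \<in> inc \<Gamma>} = t + 1"
  using order unfolding has_order_def by blast+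

lemma finite_points_on: "finite {p. (p, l) \<in> inc \<Gamma>}"
  by (rule finite_point_set) (use inc_in_geometry(1) in blast)

lemma pdist_even: "p \<in> points \<Gamma> \<Longrightarrow> q \<in> points \<Gamma> \<Longrightarrow> even (pdist p q)"
  and ldist_odd: "l \<in> lines \<Gamma> \<Longrightarrow> q \<in> points \<Gamma> \<Longrightarrow> odd (ldist l q)"
  by (simp_all add: dist_parity)

lemma pdist_le: "p \<in> points \<Gamma> \<Longrightarrow> q \<in> points \<Gamma> \<Longrightarrow> pdist p q \<le> 2 * m"
  by (simp add: dist_le_n)

lemma ldist_less:
  assumes "l \<in> lines \<Gamma>" "q \<in> points \<Gamma>"
  shows "ldist l q < 2 * m"
  using dist_le_n[of "Inr l" "Inl q"] ldist_odd[OF assms] assms by (cases "ldist l q = 2 * m") auto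

lemma pdist_ldist:
  assumes "(p, l) \<in> inc \<Gamma>" "q \<in> points \<Gamma>"
  shows "ldist l q = Suc (pdist p q) \<or> pdist p q = Suc (ldist l q)"
  using dist_neighbour[of "Inl p" "Inr l" "Inl q"] assms by simp

text \<open>A point-line distance is odd, hence smaller than the diameter 2m, so uniqueness holds
  for every point q. In \<open>projection_on_point_unique\<close> opposite points have to be
  excluded.\<close>

lemma projection_on_line_unique:
  assumes "(p, l) \<in> inc \<Gamma>" "(p', l) \<in> inc \<Gamma>" "q \<in> points \<Gamma>"
    and "ldist l q = Suc (pdist p q)" "ldist l q = Suc (pdist p' q)"
  shows "p = p'"
proof -
  have "Inl p = (Inl p' :: 'p + 'l)"
    by (rule projection_unique[of "Inr l" _ _ "Inl q"])
      (simp_all add: assms(1-3) ldist_less inc_in_geometry(2)[OF assms(1)] assms(4)[symmetric]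
        assms(5)[symmetric])
  then show ?thesis by simp
qed

lemma projection_on_point_unique:
  assumes "(p, l) \<in> inc \<Gamma>" "(p, l') \<in> inc \<Gamma>" "q \<in> points \<Gamma>" "pdist p q < 2 * m"
    and "pdist p q = Suc (ldist l q)" "pdist p q = Suc (ldist l' q)"
  shows "l = l'"
proof -
  have "Inr l = (Inr l' :: 'p + 'l)"
    by (rule projection_unique[of "Inl p" _ _ "Inl q"])
      (simp_all add: assms(1-4) assms(5)[symmetric] assms(6)[symmetric])
  then show ?thesis by simp
qed

lemma two_neighbours:
  assumes "x \<in> V"
  shows "\<exists>y. (x, y) \<in> G \<and> y \<noteq> z"
proof (cases x)
  case (Inl p)
  have "\<exists>l. (p, l) \<in> inc \<Gamma> \<and> l \<noteq> l0" for l0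
  proof (rule ccontr)
    assume "\<not> ?thesis"
    then have "{l. (p, l) \<in> inc \<Gamma>} \<subseteq> {l0}" by auto
    from card_mono[OF _ this] show False using card_lines_on[of p] assms Inl t_pos by simp
  qed
  \<comment> \<open>If z is a point, \<open>projr z\<close> is unspecified, but then any line
    differs from z.\<close>
  then obtain l where "(p, l) \<in> inc \<Gamma>" "l \<noteq> projr z" by blast
  then show ?thesis using Inl by (intro exI[of _ "Inr l"]) auto
next
  case (Inr l)
  have "\<exists>p. (p, l) \<in> inc \<Gamma> \<and> p \<noteq> p0" for p0
  proof (rule ccontr)
    assume "\<not> ?thesis"
    then have "{p. (p, l) \<in> inc \<Gamma>} \<subseteq> {p0}" by auto
    from card_mono[OF _ this] show False using card_points_on[of l] assms Inr s_pos by simp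
  qed
  then obtain p where "(p, l) \<in> inc \<Gamma>" "p \<noteq> projl z" by blast
  then show ?thesis using Inr by (intro exI[of _ "Inl p"]) auto
qed

text \<open>Iterates \<open>dist_extend\<close>; the triangle inequality makes the added piece
  geodesic as well.\<close>

lemma dist_extend_by:
  assumes "x \<in> V" "y \<in> V" "\<delta> x y + j \<le> 2 * m"
  shows "\<exists>w\<in>V. \<delta> x w = \<delta> x y + j \<and> \<delta> y w = j"
  using assms(3)
proof (induction j)
  case 0
  then show ?case using assms(2) by auto
next
  case (Suc j)
  then obtain w where w: "w \<in> V" "\<delta> x w = \<delta> x y + j" "\<delta> y w = j" by auto
  have "\<delta> x w < 2 * m" using w(2) Suc.prems by simp
  from dist_extend[OF assms(1) w(1) this two_neighbours[OF w(1)]]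
  obtain w' where w': "(w, w') \<in> G" "\<delta> x w' = Suc (\<delta> x w)" by blast
  have V: "w' \<in> V" using edge_in_elements[OF w'(1)] by simp
  have "\<delta> y w' = Suc j"
    using dist_triangle[OF assms(1,2) V] dist_triangle[OF assms(2) w(1) V] w w' dist_edge[OF w'(1)]
    by simp
  then show ?case using w w' V by auto
qed

section \<open>Walking away from a set of points\<close>

text \<open>Each q in A lies in the direction of just one line through p or of none, so at most t of
  the t + 1 lines lead towards A.\<close>

lemma free_line:
  assumes "p \<in> points \<Gamma>" "A \<subseteq> points \<Gamma>" "card A \<le> t" "\<And>q. q \<in> A \<Longrightarrow> pdist p q < 2 * m"
  obtains x where "(p, x) \<in> inc \<Gamma>" "\<And>q. q \<in> A \<Longrightarrow> ldist x q = Suc (pdist p q)"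
proof -
  define L where "L = {x. (p, x) \<in> inc \<Gamma> \<and> (\<exists>q\<in>A. pdist p q = Suc (ldist x q))}"
  have finA: "finite A" using assms(2) by (rule finite_point_set)
  have "card L \<le> card A"
  proof (rule card_le_if_injective_relation[where R = "\<lambda>x q. pdist p q = Suc (ldist x q)"])
    show "x = x'" if "x \<in> L" "x' \<in> L" "q \<in> A" "pdist p q = Suc (ldist x q)"
      "pdist p q = Suc (ldist x' q)" for x x' q
      using projection_on_point_unique[of p x x' q] that assms(2) assms(4)[OF that(3)]
      by (auto simp: L_def)
  qed (auto simp: L_def finA)
  then have "card L < card {x. (p, x) \<in> inc \<Gamma>}"
    using assms(1,3) card_lines_on by simp
  then have "L \<noteq> {x. (p, x) \<in> inc \<Gamma>}" by auto
  then obtain x where x: "(p, x) \<in> inc \<Gamma>" "x \<notin> L" by (auto simp: L_def)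
  have "ldist x q = Suc (pdist p q)" if "q \<in> A" for q
    using pdist_ldist[OF x(1), of q] x that assms(2) by (auto simp: L_def)
  with x that show ?thesis by blast
qed

text \<open>Every point of x other than p is two steps farther from the points not opposite p. A
  point q opposite p fails to be opposite to just one point of x, its projection; so fewer than s
  points of x are spoiled and, with p also excluded, one of the s + 1 remains.\<close>

lemma step_away:
  assumes x: "(p, x) \<in> inc \<Gamma>" and S: "S \<subseteq> points \<Gamma>"
    and free: "\<And>q. q \<in> S \<Longrightarrow> pdist p q < 2 * m \<Longrightarrow> ldist x q = Suc (pdist p q)"
    and few: "card {q \<in> S. pdist p q = 2 * m} < s"
  obtains r where "(r, x) \<in> inc \<Gamma>"
    "\<And>q. q \<in> S \<Longrightarrow> pdist p q < 2 * m \<Longrightarrow> pdist r q = pdist p q + 2"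
    "\<And>q. q \<in> S \<Longrightarrow> pdist p q = 2 * m \<Longrightarrow> pdist r q = 2 * m"
proof -
  note px = inc_in_geometry[OF x]
  define B where "B = {q \<in> S. pdist p q = 2 * m}"
  define bad where "bad = {r. (r, x) \<in> inc \<Gamma> \<and> (\<exists>q\<in>B. pdist r q < 2 * m)}"
  have finB: "finite B" using finite_point_set[OF S] by (simp add: B_def)
  have far: "ldist x q = Suc (pdist r q)" if "q \<in> B" "(r, x) \<in> inc \<Gamma>" "pdist r q < 2 * m" for r q
  proof -
    have q: "q \<in> points \<Gamma>" "pdist p q = 2 * m" using that S by (auto simp: B_def)
    have "2 * m = Suc (ldist x q)"
      using pdist_ldist[OF x q(1)] q ldist_less[OF px(2) q(1)] by auto
    then show ?thesis using pdist_ldist[OF that(2) q(1)] that(3) by auto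
  qed
  have "card bad \<le> card B"
  proof (rule card_le_if_injective_relation[where R = "\<lambda>r q. pdist r q < 2 * m"])
    show "r = r'" if "r \<in> bad" "r' \<in> bad" "q \<in> B" "pdist r q < 2 * m" "pdist r' q < 2 * m" for r r' q
      using projection_on_line_unique[of r x r' q] far[of q r] far[of q r'] that S
      by (auto simp: bad_def B_def)
  qed (auto simp: bad_def finB)
  moreover have "finite bad"
    by (rule finite_subset[OF _ finite_points_on[of x]]) (auto simp: bad_def)
  ultimately have "card (insert p bad) \<le> s"
    using few by (simp add: B_def[symmetric] card_insert_if)
  then have "card (insert p bad) < card {r. (r, x) \<in> inc \<Gamma>}"
    using card_points_on px by simp
  then have "insert p bad \<noteq> {r. (r, x) \<in> inc \<Gamma>}" by auto
  then obtain r where r: "(r, x) \<in> inc \<Gamma>" "r \<noteq> p" "r \<notin> bad" using x by (auto simp: bad_def)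
  show ?thesis
  proof (rule that[OF r(1)])
    fix q assume q: "q \<in> S"
    then have qP: "q \<in> points \<Gamma>" using S by auto
    show "pdist r q = pdist p q + 2" if "pdist p q < 2 * m"
      using pdist_ldist[OF r(1) qP] projection_on_line_unique[OF r(1) x qP] free[OF q that] r(2)
      by auto
    show "pdist r q = 2 * m" if "pdist p q = 2 * m"
      using r q that pdist_le[OF inc_in_geometry(1)[OF r(1)] qP] by (auto simp: bad_def B_def)
  qed
qed

text \<open>At each of at most k steps the points not yet opposite recede by 2. The bound on
  \<open>pdist p r\<close> serves in \<open>small_support_blocking\<close> to keep r from being
  opposite the starting point.\<close>

lemma exists_opposite_to_all:
  assumes "S \<subseteq> points \<Gamma>" "card S \<le> s" "p \<in> points \<Gamma>" "\<And>q. q \<in> S \<Longrightarrow> 2 * m \<le> pdist p q + 2 * k"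
  shows "\<exists>r\<in>points \<Gamma>. pdist p r \<le> 2 * k \<and> (\<forall>q\<in>S. pdist r q = 2 * m)"
  using assms(3,4)
proof (induction k arbitrary: p)
  case 0
  have "pdist p q = 2 * m" if "q \<in> S" for q
    using pdist_le[of p q] that subsetD[OF assms(1) that] "0"(1) "0"(2)[OF that] by simp
  then show ?case using 0 by (intro bexI[of _ p]) auto
next
  case (Suc k)
  define A where "A = {q \<in> S. pdist p q < 2 * m}"
  have finS: "finite S" using assms(1) by (rule finite_point_set)
  show ?case
  proof (cases "A = {}")
    case True
    then have "pdist p q = 2 * m" if "q \<in> S" for q
      using pdist_le[of p q] that subsetD[OF assms(1) that] Suc.prems(1) by (auto simp: A_def)
    then show ?thesis using Suc.prems(1) by (intro bexI[of _ p]) auto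
  next
    case False
    have cA: "card A \<le> s" using card_mono[OF finS, of A] assms(2) by (auto simp: A_def)
    obtain x where x: "(p, x) \<in> inc \<Gamma>" "\<And>q. q \<in> A \<Longrightarrow> ldist x q = Suc (pdist p q)"
    proof (rule free_line[OF Suc.prems(1), of A])
      show "A \<subseteq> points \<Gamma>" using assms(1) by (auto simp: A_def)
      show "card A \<le> t" using cA s_le_t by simp
    qed (auto simp: A_def)
    \<comment> \<open>\<open>step_away\<close> wants fewer than s points already opposite; a is a
      point that is not.\<close>
    obtain a where "a \<in> S" "pdist p a < 2 * m" using False by (auto simp: A_def)
    then have "a \<in> S" "a \<notin> {q \<in> S. pdist p q = 2 * m}" by simp_all
    then have "{q \<in> S. pdist p q = 2 * m} \<subset> S" by blast
    from psubset_card_mono[OF finS this] have few: "card {q \<in> S. pdist p q = 2 * m} < s"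
      using assms(2) by simp
    have free: "ldist x q = Suc (pdist p q)" if "q \<in> S" "pdist p q < 2 * m" for q
      using x(2) that by (simp add: A_def)
    obtain r where r: "(r, x) \<in> inc \<Gamma>"
      "\<And>q. q \<in> S \<Longrightarrow> pdist p q < 2 * m \<Longrightarrow> pdist r q = pdist p q + 2"
      "\<And>q. q \<in> S \<Longrightarrow> pdist p q = 2 * m \<Longrightarrow> pdist r q = 2 * m"
      using step_away[OF x(1) assms(1) free few] by blast
    have rP: "r \<in> points \<Gamma>" using inc_in_geometry(1)[OF r(1)] .
    have "2 * m \<le> pdist r q + 2 * k" if "q \<in> S" for q
      using r(2,3)[OF that] Suc.prems(2)[OF that]
        le_neq_implies_less[OF pdist_le[OF Suc.prems(1) subsetD[OF assms(1) that]]]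
      by (cases "pdist p q = 2 * m") simp_all
    from Suc.IH[OF rP this] obtain r' where r': "r' \<in> points \<Gamma>" "pdist r r' \<le> 2 * k"
      "\<forall>q\<in>S. pdist r' q = 2 * m" by blast
    have "pdist p r \<le> 2"
      using dist_triangle[of "Inl p" "Inr x" "Inl r"] dist_edge[of "Inl p" "Inr x"]
        dist_edge[of "Inr x" "Inl r"] x(1) r(1) inc_in_geometry[OF x(1)] rP by simp
    then have "pdist p r' \<le> 2 * Suc k"
      using dist_triangle[of "Inl p" "Inl r" "Inl r'"] r' rP Suc.prems(1) by simp
    then show ?thesis using r' by blast
  qed
qed

end

section \<open>Blocking sets with respect to opposition\<close>

text \<open>By \<open>exists_opposite_to_all\<close> fewer than s + 1 points never block, so these
  sets have the least possible size.\<close>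

locale blocking_set = even_polygon_order \<Gamma> m s t
  for \<Gamma> :: "('p, 'l) geometry" and m s t :: nat +
  fixes S :: "'p set"
  assumes S_points: "S \<subseteq> points \<Gamma>" and card_S: "card S = s + 1"
    and blocking: "p \<in> points \<Gamma> \<Longrightarrow> \<exists>q\<in>S. pdist p q < 2 * m"
begin

lemma finite_S: "finite S"
  using S_points by (rule finite_point_set)

text \<open>Otherwise one walks away from \<open>p\<close>: points opposite \<open>p\<close> stay opposite, the others recede,
  and since \<open>q0\<close> and \<open>q1\<close> are nearest they never leave less than two points to take care of,
  until all of \<open>S\<close> is opposite.\<close>

lemma exists_nearer:
  assumes "q0 \<in> S" "q1 \<in> S" "q0 \<noteq> q1" "(p, x0) \<in> inc \<Gamma>" "pdist p q0 = D" "pdist p q1 = D"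
    and "D = Suc (ldist x0 q0)" "D = Suc (ldist x0 q1)"
  shows "\<exists>q\<in>S. pdist p q < D"
  using assms(4-8)
proof (induction "2 * m - D" arbitrary: p x0 D rule: less_induct)
  case less
  have p: "p \<in> points \<Gamma>" "x0 \<in> lines \<Gamma>" using inc_in_geometry[OF less.prems(1)] by auto
  have q: "q0 \<in> points \<Gamma>" "q1 \<in> points \<Gamma>" using assms(1,2) S_points by auto
  have D_le: "D \<le> 2 * m" using pdist_le[OF p(1) q(1)] less.prems(2) by simp
  show ?case
  proof (rule ccontr)
    assume "\<not> ?thesis"
    then have near: "D \<le> pdist p q" if "q \<in> S" for q using that by (simp add: not_less)
    show False
    proof (cases "D = 2 * m")
      case True
      then show False using blocking[OF p(1)] near by (auto simp: not_less[symmetric])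
    next
      case False
      then have D: "D < 2 * m" using D_le by simp
      then have D2: "D + 2 \<le> 2 * m"
        using pdist_even[OF p(1) q(1)] less.prems(2) by presburger
      define A where "A = {q \<in> S. pdist p q < 2 * m}"
      define B where "B = {q \<in> S. pdist p q = 2 * m}"
      \<comment> \<open>Leaving out q1 leaves at most s, hence at most t, points, as
        \<open>free_line\<close> requires.\<close>
      have "A - {q1} \<subseteq> S - {q1}" by (auto simp: A_def)
      from card_mono[OF _ this] have cA: "card (A - {q1}) \<le> t"
        using finite_S card_S assms(2) s_le_t by simp
      have "B \<subseteq> S - {q0, q1}"
        using less.prems(2,3) D by (auto simp: B_def)
      from card_mono[OF _ this] have cB: "card B < s"
        using finite_S card_S assms(1-3) s_pos by (simp add: card_Diff_subset)
      have AP: "A - {q1} \<subseteq> points \<Gamma>" using S_points by (auto simp: A_def)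
      have A_less: "pdist p q < 2 * m" if "q \<in> A - {q1}" for q using that by (simp add: A_def)
      obtain x where x: "(p, x) \<in> inc \<Gamma>"
        "\<And>q. q \<in> A - {q1} \<Longrightarrow> ldist x q = Suc (pdist p q)"
        using free_line[OF p(1) AP cA A_less] by blast
      have xq0: "ldist x q0 = Suc D"
        using x(2)[of q0] assms(1,3) less.prems(2) D by (simp add: A_def)
      \<comment> \<open>The line x0 leads from p to both q0 and q1. As x leads away from q0, it is
        not x0 and leads away from q1 too.\<close>
      have xq1: "ldist x q1 = Suc D"
      proof (rule ccontr)
        assume "ldist x q1 \<noteq> Suc D"
        then have "pdist p q1 = Suc (ldist x q1)"
          using pdist_ldist[OF x(1) q(2)] less.prems(3) by auto
        moreover have "pdist p q1 = Suc (ldist x0 q1)" "pdist p q1 < 2 * m"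
          using less.prems(3,5) D by linarith+
        ultimately have "x = x0"
          using projection_on_point_unique[OF x(1) less.prems(1) q(2)] by blast
        then show False using xq0 less.prems(4) by simp
      qed
      have free: "ldist x q = Suc (pdist p q)" if "q \<in> S" "pdist p q < 2 * m" for q
        using x(2)[of q] that xq1 less.prems(3) by (cases "q = q1") (simp_all add: A_def)
      obtain r where r: "(r, x) \<in> inc \<Gamma>"
        "\<And>q. q \<in> S \<Longrightarrow> pdist p q < 2 * m \<Longrightarrow> pdist r q = pdist p q + 2"
        "\<And>q. q \<in> S \<Longrightarrow> pdist p q = 2 * m \<Longrightarrow> pdist r q = 2 * m"
        using step_away[OF x(1) S_points free cB[unfolded B_def]] by blast
      have rq: "pdist r q0 = D + 2" "pdist r q1 = D + 2"
        using r(2)[OF assms(1)] r(2)[OF assms(2)] less.prems(2,3) D by simp_all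
      \<comment> \<open>The induction continues at r, from which x leads to both q0 and q1.\<close>
      have "2 * m - (D + 2) < 2 * m - D" "D + 2 = Suc (ldist x q0)" "D + 2 = Suc (ldist x q1)"
        using xq0 xq1 D by simp_all
      from less.hyps[OF this(1) r(1) rq this(2,3)]
      obtain q' where q': "q' \<in> S" "pdist r q' < D + 2" by blast
      \<comment> \<open>Since D + 2 \<le> 2m, such a q' was not opposite p, and so was nearer than D
        to p.\<close>
      show False
        using r(2,3)[OF q'(1)] near[OF q'(1)] q'(2) D2
          le_neq_implies_less[OF pdist_le[OF p(1) subsetD[OF S_points q'(1)]]]
        by (cases "pdist p q' = 2 * m") simp_all
    qed
  qed
qed

text \<open>Every point r of l is the projection of a point of S at distance D: of q0 or q1, or else
  of the point that \<open>exists_nearer\<close> yields at r. These s + 1 points exhaust S.\<close>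

lemma equidistant_from_line:
  assumes "q0 \<in> S" "q1 \<in> S" "q0 \<noteq> q1" "l \<in> lines \<Gamma>" "ldist l q0 = D" "ldist l q1 = D"
    and far: "\<And>q. q \<in> S \<Longrightarrow> D \<le> ldist l q" and q: "q \<in> S"
  shows "ldist l q = D"
proof -
  define T where "T = {q \<in> S. ldist l q = D}"
  have "s + 1 \<le> card T"
    unfolding card_points_on[OF assms(4), symmetric]
  proof (rule card_le_if_injective_relation[where R = "\<lambda>r q. D = Suc (pdist r q)"])
    show "finite T" using finite_S by (simp add: T_def)
    show "r = r'" if "r \<in> {p. (p, l) \<in> inc \<Gamma>}" "r' \<in> {p. (p, l) \<in> inc \<Gamma>}" "q \<in> T"
      "D = Suc (pdist r q)" "D = Suc (pdist r' q)" for r r' q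
      using projection_on_line_unique[of r l r' q] that S_points by (auto simp: T_def)
  next
    fix r assume "r \<in> {p. (p, l) \<in> inc \<Gamma>}"
    then have r: "(r, l) \<in> inc \<Gamma>" by simp
    have "\<exists>q\<in>S. pdist r q < Suc D"
    proof (cases "pdist r q0 = Suc D \<and> pdist r q1 = Suc D")
      case True
      have "Suc D = Suc (ldist l q0)" "Suc D = Suc (ldist l q1)" using assms(5,6) by simp_all
      with True show ?thesis using exists_nearer[OF assms(1-3) r] by blast
    next
      case False
      then have "pdist r q0 < Suc D \<or> pdist r q1 < Suc D"
        using pdist_ldist[OF r subsetD[OF S_points assms(1)]]
          pdist_ldist[OF r subsetD[OF S_points assms(2)]] assms(5,6) by linarith
      then show ?thesis using assms(1,2) by blast
    qed
    then obtain q where q: "q \<in> S" "pdist r q < Suc D" by blast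
    have "ldist l q = Suc (pdist r q)"
      using pdist_ldist[OF r subsetD[OF S_points q(1)]] far[OF q(1)] q(2) by linarith
    \<comment> \<open>Both numbers are odd, so D \<le> \<open>ldist l q\<close> < D + 2 leaves only
      D.\<close>
    moreover have "odd (ldist l q)" "odd D"
      using ldist_odd[OF assms(4)] S_points q(1) assms(1,5) by auto
    ultimately have "D = Suc (pdist r q)" "ldist l q = D"
      using far[OF q(1)] q(2) by presburger+
    then show "\<exists>q\<in>T. D = Suc (pdist r q)" using q(1) by (auto simp: T_def)
  qed
  then have "T = S"
    using card_S finite_S by (intro card_seteq) (auto simp: T_def)
  then show ?thesis using q by (auto simp: T_def)
qed

text \<open>If some line x through p led to no point of S at distance D,
  \<open>exists_nearer\<close> would give each of the s other points of x a point of S projecting to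
  it, distinct from q0 and q1: too many. So t + 1 \<le> |T| \<le> s + 1, and s \<le> t forces
  equality.\<close>

lemma equidistant_from_point:
  assumes "q0 \<in> S" "q1 \<in> S" "q0 \<noteq> q1" "p \<in> points \<Gamma>" "pdist p q0 = D" "pdist p q1 = D" "D < 2 * m"
    and far: "\<And>q. q \<in> S \<Longrightarrow> D \<le> pdist p q"
  shows "s = t" and "q \<in> S \<Longrightarrow> pdist p q = D"
proof -
  define T where "T = {q \<in> S. pdist p q = D}"
  have finT: "finite T" using finite_S by (simp add: T_def)
  have qP: "q0 \<in> points \<Gamma>" "q1 \<in> points \<Gamma>" using assms(1,2) S_points by auto
  have "t + 1 \<le> card T"
    unfolding card_lines_on[OF assms(4), symmetric]
  proof (rule card_le_if_injective_relation[where R = "\<lambda>x q. D = Suc (ldist x q)", OF finT])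
    show "x = x'" if "x \<in> {l. (p, l) \<in> inc \<Gamma>}" "x' \<in> {l. (p, l) \<in> inc \<Gamma>}" "q \<in> T"
      "D = Suc (ldist x q)" "D = Suc (ldist x' q)" for x x' q
      using projection_on_point_unique[of p x x' q] that S_points assms(7) by (auto simp: T_def)
  next
    fix x assume "x \<in> {l. (p, l) \<in> inc \<Gamma>}"
    then have x: "(p, x) \<in> inc \<Gamma>" by simp
    show "\<exists>q\<in>T. D = Suc (ldist x q)"
    proof (rule ccontr)
      assume no: "\<not> ?thesis"
      have ge: "Suc D \<le> ldist x q" if "q \<in> S" for q
      proof (cases "pdist p q = D")
        case True
        then show ?thesis
          using pdist_ldist[OF x subsetD[OF S_points that]] no that by (auto simp: T_def)
      next
        case False
        have "even (pdist p q)" "even D"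
          using pdist_even[OF assms(4)] subsetD[OF S_points that] qP(1) assms(5) by auto
        then have "Suc (Suc D) \<le> pdist p q" using far[OF that] False by presburger
        then show ?thesis using pdist_ldist[OF x subsetD[OF S_points that]] by linarith
      qed
      have x01: "ldist x q0 = Suc D" "ldist x q1 = Suc D"
        using pdist_ldist[OF x qP(1)] pdist_ldist[OF x qP(2)] ge[OF assms(1)] ge[OF assms(2)]
          assms(5,6) by auto
      have "card ({r. (r, x) \<in> inc \<Gamma>} - {p}) \<le> card (S - {q0, q1})"
      proof (rule card_le_if_injective_relation[where R = "\<lambda>r q. ldist x q = Suc (pdist r q)"])
        show "finite (S - {q0, q1})" using finite_S by simp
        show "r = r'" if "r \<in> {r. (r, x) \<in> inc \<Gamma>} - {p}" "r' \<in> {r. (r, x) \<in> inc \<Gamma>} - {p}"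
          "q \<in> S - {q0, q1}" "ldist x q = Suc (pdist r q)" "ldist x q = Suc (pdist r' q)" for r r' q
          using projection_on_line_unique[of r x r' q] that S_points by auto
      next
        fix r assume "r \<in> {r. (r, x) \<in> inc \<Gamma>} - {p}"
        then have r: "(r, x) \<in> inc \<Gamma>" "r \<noteq> p" by auto
        have r01: "pdist r q0 = Suc (Suc D)" "pdist r q1 = Suc (Suc D)"
          using pdist_ldist[OF r(1) qP(1)] pdist_ldist[OF r(1) qP(2)] x01 assms(5,6)
            projection_on_line_unique[OF x r(1) qP(1)] projection_on_line_unique[OF x r(1) qP(2)] r(2)
          by auto
        have "Suc (Suc D) = Suc (ldist x q0)" "Suc (Suc D) = Suc (ldist x q1)" using x01 by simp_all
        from exists_nearer[OF assms(1-3) r(1) r01 this]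
        obtain q where q: "q \<in> S" "pdist r q < Suc (Suc D)" by blast
        have "ldist x q = Suc (pdist r q)"
          using pdist_ldist[OF r(1) subsetD[OF S_points q(1)]] ge[OF q(1)] q(2) by auto
        then show "\<exists>q\<in>S - {q0, q1}. ldist x q = Suc (pdist r q)"
          using q r01 by (intro bexI[of _ q]) auto
      qed
      then show False
        using card_points_on[OF inc_in_geometry(2)[OF x]] finite_points_on[of x] x
          finite_S card_S assms(1-3) s_pos by (simp add: card_Diff_subset)
    qed
  qed
  moreover have "card T \<le> s + 1"
    using card_mono[OF finite_S, of T] card_S by (simp add: T_def)
  ultimately show "s = t" using s_le_t by simp
  then have "T = S"
    using \<open>t + 1 \<le> card T\<close> card_S finite_S by (intro card_seteq) (auto simp: T_def)
  then show "pdist p q = D" if "q \<in> S" using that by (auto simp: T_def)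
qed

lemma equidistant:
  assumes "q0 \<in> S" "q1 \<in> S" "q0 \<noteq> q1" "e \<in> V" "\<delta> e (Inl q0) = D" "\<delta> e (Inl q1) = D" "D < 2 * m"
    and "\<And>q. q \<in> S \<Longrightarrow> D \<le> \<delta> e (Inl q)" and "q \<in> S"
  shows "\<delta> e (Inl q) = D"
proof (cases e)
  case (Inl p)
  then show ?thesis using equidistant_from_point(2)[of q0 q1 p D q] assms by simp
next
  case (Inr l)
  then show ?thesis using equidistant_from_line[of q0 q1 l D q] assms by simp
qed

section \<open>Blocking sets of s + 1 points as distance traces\<close>

lemma exists_trace: "\<exists>d x y. is_distance_trace m \<Gamma> d x y S"
proof -
  have "\<exists>q0 q1. q0 \<in> S \<and> q1 \<in> S \<and> q0 \<noteq> q1"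
  proof (rule ccontr)
    assume no: "\<not> ?thesis"
    have "S \<noteq> {}" using card_S by auto
    then obtain q where "q \<in> S" by blast
    then have "S \<subseteq> {q}" using no by blast
    from card_mono[OF _ this] show False using card_S s_pos by simp
  qed
  then obtain e where "e \<in> {(q, q'). q \<in> S \<and> q' \<in> S \<and> q \<noteq> q'}" by blast
  from ex_has_least_nat[where P = "\<lambda>e. e \<in> {(q, q'). q \<in> S \<and> q' \<in> S \<and> q \<noteq> q'}"
      and m = "\<lambda>(q, q'). pdist q q'", OF this]
  obtain q0 q1 where q01: "q0 \<in> S" "q1 \<in> S" "q0 \<noteq> q1"
    and least: "\<And>q q'. q \<in> S \<Longrightarrow> q' \<in> S \<Longrightarrow> q \<noteq> q' \<Longrightarrow> pdist q0 q1 \<le> pdist q q'"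
    by force
  have P: "q0 \<in> points \<Gamma>" "q1 \<in> points \<Gamma>" using q01 S_points by auto
  then have V: "Inl q0 \<in> V" "Inl q1 \<in> V" by auto
  obtain d where d: "pdist q0 q1 = d + d"
    using pdist_even[OF P] by (metis evenE mult_2)
  have d_pos: "1 \<le> d" using dist_eq_0[OF V] q01(3) d by (cases d) auto
  have d_le: "d \<le> m" using pdist_le[OF P] d by simp
  obtain z where z: "z \<in> V" "\<delta> (Inl q0) z = d" "\<delta> z (Inl q1) = d"
    using geodesic_between[OF V d] by blast
  have zq0: "\<delta> z (Inl q0) = d" using z(2) dist_sym[of z] by simp
  have qV: "Inl q \<in> V" if "q \<in> S" for q using that S_points by auto
  \<comment> \<open>A point of S nearer than d to z would be nearer than 2d to q0, against
    minimality.\<close>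
  have z_far: "d \<le> \<delta> z (Inl q)" if "q \<in> S" for q
  proof (cases "q = q0")
    case False
    have "d + d \<le> pdist q0 q" using least[OF q01(1) that] False d by simp
    then show ?thesis using dist_triangle[OF V(1) z(1) qV[OF that]] z(2) by simp
  qed (simp add: zq0)
  have zS: "\<delta> z (Inl q) = d" if "q \<in> S" for q
    using equidistant[OF q01 z(1) zq0 z(3) _ z_far that] d_le d_pos by simp
  \<comment> \<open>The geodesic from q1 through z to q0 is prolonged to w opposite q1; for d = m
    this adds no step.\<close>
  obtain w where w: "w \<in> V" "\<delta> (Inl q1) w = 2 * m" "\<delta> (Inl q0) w = 2 * m - 2 * d"
    using dist_extend_by[OF V(2,1), of "2 * m - 2 * d"] d d_le dist_sym[of "Inl q1" "Inl q0"] by auto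
  have zw: "\<delta> z w = 2 * m - d"
    using dist_triangle[OF V(2) z(1) w(1)] dist_triangle[OF z(1) V(1) w(1)] w zq0 z(3) d_le
      dist_sym[of "Inl q1" z] by simp
  have "\<delta> z w < 2 * m" using zw d_pos d_le by simp
  \<comment> \<open>Past w the walk goes on away from z. As w is opposite q1, any neighbour u of w
    already leads back towards q1; y is reached d steps after w.\<close>
  from dist_extend[OF z(1) w(1) this two_neighbours[OF w(1)]]
  obtain u where u: "(w, u) \<in> G" "\<delta> z u = Suc (\<delta> z w)" by blast
  have uV: "u \<in> V" using edge_in_elements[OF u(1)] by simp
  have wq1: "\<delta> w (Inl q1) = 2 * m" using w(2) dist_sym[of w] by simp
  have "\<delta> u (Inl q1) = (d - 1) + (2 * m - d)"
    using dist_neighbour[OF u(1) V(2)] wq1 dist_le_n[OF uV V(2)] d_pos d_le by auto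
  then obtain y where y: "y \<in> V" "\<delta> u y = d - 1" "\<delta> y (Inl q1) = 2 * m - d"
    using geodesic_between[OF uV V(2)] by blast
  have wy: "\<delta> w y = Suc (d - 1)"
    using dist_triangle[OF w(1) uV y(1)] dist_edge[OF u(1)] dist_triangle[OF w(1) y(1) V(2)] y wq1
      d_pos d_le by simp
  \<comment> \<open>From z over w and u to y there is no backtracking, and the length is (2m - d) +
    d.\<close>
  have zy: "\<delta> z y = 2 * m"
    using dist_concat[OF z(1) y(1) u y(2) wy] zw d_pos d_le by simp
  have y_far: "2 * m - d \<le> \<delta> y (Inl q)" if "q \<in> S" for q
    using dist_triangle[OF z(1) qV[OF that] y(1)] zS[OF that] zy dist_sym[of y "Inl q"] by simp
  have yq0: "\<delta> y (Inl q0) = 2 * m - d"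
    using y_far[OF q01(1)] dist_triangle[OF y(1) w(1) V(1)] wy w(3)
      dist_sym[of w "Inl q0"] dist_sym[of y w]
      d_pos d_le by simp
  have yS: "\<delta> y (Inl q) = 2 * m - d" if "q \<in> S" for q
    using equidistant[OF q01 y(1) yq0 y(3) _ y_far that] d_le d_pos by simp
  define T where "T = trace_set m \<Gamma> d z y"
  have T: "p \<in> T \<longleftrightarrow> p \<in> points \<Gamma> \<and> \<delta> z (Inl p) = d \<and> \<delta> y (Inl p) = 2 * m - d" for p
    using z(1) y(1) by (auto simp: T_def trace_set_def points_at_def distance_eq_dist_nat)
  have finT: "finite T" by (rule finite_point_set) (auto simp: T)
  \<comment> \<open>A point p of T is determined by a first step r from z towards it: r has distance
    2m - 1 from y, so only one geodesic joins them, and p lies on it.\<close>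
  have "card T \<le> card {r. (z, r) \<in> G}"
  proof (rule card_le_if_injective_relation[where R = "\<lambda>p r. \<delta> r (Inl p) = d - 1"])
    show "finite {r. (z, r) \<in> G}"
      by (rule finite_subset[of _ V])
        (use finite_geometry edge_in_elements in \<open>auto simp: elements_def finite_geometry_def\<close>)
    show "\<exists>r\<in>{r. (z, r) \<in> G}. \<delta> r (Inl p) = d - 1" if "p \<in> T" for p
    proof -
      have "\<delta> z (Inl p) = 1 + (d - 1)" "Inl p \<in> V" using that d_pos by (auto simp: T)
      from geodesic_between[OF z(1) this(2,1)] show ?thesis
        using dist_1_edge[OF z(1)] by (metis mem_Collect_eq)
    qed
    show "p = p'" if "p \<in> T" "p' \<in> T" "r \<in> {r. (z, r) \<in> G}"
      "\<delta> r (Inl p) = d - 1" "\<delta> r (Inl p') = d - 1" for p p' r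
    proof -
      have zr: "(z, r) \<in> G" using that by simp
      have r: "r \<in> V" using edge_in_elements[OF zr] by simp
      have ry: "\<delta> r y = (d - 1) + (2 * m - d)"
        using dist_neighbour[OF zr y(1)] zy dist_le_n[OF r y(1)] d_pos d_le by auto
      have "Inl p = (Inl p' :: 'p + 'l)"
        by (rule geodesic_unique[OF r y(1) _ _ _ ry])
          (use that d_pos d_le dist_sym[of y "Inl p"] dist_sym[of y "Inl p'"] in \<open>auto simp: T\<close>)
      then show ?thesis by simp
    qed
  qed
  \<comment> \<open>A point z has t + 1 neighbours, but then \<open>equidistant_from_point\<close>
    gives s = t.\<close>
  also have "card {r. (z, r) \<in> G} \<le> s + 1"
  proof (cases z)
    case (Inl p)
    then have p: "p \<in> points \<Gamma>" using z(1) by simp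
    have "d < 2 * m" using d_pos d_le by simp
    then have "s = t"
      using equidistant_from_point(1)[OF q01 p _ _ _ z_far[unfolded Inl]] zq0 z(3) Inl by simp
    moreover have "{r. (z, r) \<in> G} = Inr ` {l. (p, l) \<in> inc \<Gamma>}"
      using Inl by (auto simp: incidence_graph_def)
    ultimately show ?thesis using card_lines_on[OF p] by (simp add: card_image)
  next
    case (Inr l)
    then have l: "l \<in> lines \<Gamma>" using z(1) by simp
    have "{r. (z, r) \<in> G} = Inl ` {p. (p, l) \<in> inc \<Gamma>}"
      using Inr by (auto simp: incidence_graph_def)
    then show ?thesis using card_points_on[OF l] by (simp add: card_image)
  qed
  finally have "card T \<le> card S" using card_S by simp
  moreover have "S \<subseteq> T" using zS yS S_points by (auto simp: T)
  ultimately have "S = T" using finT by (intro card_seteq) auto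
  then have "is_distance_trace m \<Gamma> d z y S"
    using d_pos d_le z(1) y(1) zy q01(1)
    by (auto simp: is_distance_trace_def opposite_def distance_eq_dist_nat T_def)
  then show ?thesis by blast
qed

text \<open>For even d the element x is a point at the same distance d < 2m from all of S, which by
  \<open>equidistant_from_point\<close> happens only for s = t.\<close>

lemma trace_distance_odd:
  assumes "is_distance_trace m \<Gamma> d x y S" "s < t"
  shows "odd d"
proof
  assume "even d"
  have tr: "d \<in> {1..m}" "x \<in> V" "S = trace_set m \<Gamma> d x y" "S \<noteq> {}"
    using assms(1) by (auto simp: is_distance_trace_def opposite_def)
  have xS: "\<delta> x (Inl q) = d" if "q \<in> S" for q
    using that tr(2,3) S_points by (auto simp: trace_set_def points_at_def distance_eq_dist_nat)
  obtain q0 where q0: "q0 \<in> S" using tr(4) by blast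
  have "card (S - {q0}) = s" using card_S finite_S q0 by simp
  then have "S - {q0} \<noteq> {}" using s_pos by force
  then obtain q1 where q1: "q1 \<in> S" "q1 \<noteq> q0" by blast
  have "isl x"
    using dist_parity[OF tr(2), of "Inl q0"] xS[OF q0] q0 S_points \<open>even d\<close> by auto
  then obtain p where p: "x = Inl p" by (auto simp: isl_def)
  have "s = t"
    by (rule equidistant_from_point(1)[OF q0 q1(1), of p d])
      (use q0 q1 xS p tr in \<open>auto\<close>)
  then show False using assms(2) by simp
qed

end

section \<open>Code words\<close>

text \<open>The h of the weights. As j stops at k - 1, opposite points get weight h(0) = 0; moreover
  h(1) = 1, and h(2), ..., h(m) are the field elements that the theorem assumes to be
  nonzero.\<close>

definition alt_geom_sum :: "nat \<Rightarrow> nat \<Rightarrow> 'f::field" where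
  "alt_geom_sum s k = (\<Sum>j<k. (- of_nat s) ^ j)"

lemma alt_geom_sum_0 [simp]: "alt_geom_sum s 0 = 0"
  by (simp add: alt_geom_sum_def)

lemma alt_geom_sum_Suc: "alt_geom_sum s (Suc k) + of_nat s * alt_geom_sum s k = 1"
  by (simp add: alt_geom_sum_def sum.lessThan_Suc_shift sum_distrib_left sum_negf
      del: sum.lessThan_Suc)

lemma of_int_alt_geom_sum: "of_int (\<Sum>j=0..k. (- int s) ^ j) = alt_geom_sum s (Suc k)"
  by (simp add: alt_geom_sum_def lessThan_Suc_atMost atLeast0AtMost)

section \<open>Weighted sums over code words and the weight bound\<close>

context even_polygon_order
begin

lemma points_at_1_line: "l \<in> lines \<Gamma> \<Longrightarrow> points_at \<Gamma> 1 (Inr l) = {p. (p, l) \<in> inc \<Gamma>}"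
  using dist_edge[of "Inr l" "Inl _"] dist_1_edge[of "Inr l" "Inl _"] inc_in_geometry(1)
  by (auto simp: points_at_def distance_eq_dist_nat one_enat_def)

lemma line_indicator_eq:
  "l \<in> lines \<Gamma> \<Longrightarrow> line_indicator \<Gamma> l q = (if (q, l) \<in> inc \<Gamma> then 1 else 0)"
  by (simp add: line_indicator_def points_at_1_line[simplified] indicator_def)

text \<open>The weights are chosen such that every line has total weight \<open>1\<close>: a line has a unique point
  nearest to \<open>p\<close>, and its other \<open>s\<close> points lie two steps further away.\<close>

lemma line_weight_sum:
  assumes "p \<in> points \<Gamma>" "l \<in> lines \<Gamma>"
  shows "(\<Sum>q | (q, l) \<in> inc \<Gamma>. alt_geom_sum s (m - pdist p q div 2)) = (1 :: 'f::field)"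
proof -
  have V: "Inr l \<in> V" "Inl p \<in> V" using assms by auto
  obtain i where i: "ldist l p = 1 + 2 * i"
    using ldist_odd[OF assms(2,1)] by (metis oddE add.commute)
  have i_less: "i < m" using ldist_less[OF assms(2,1)] i by simp
  obtain r where r: "r \<in> V" "\<delta> (Inr l) r = 1" "\<delta> r (Inl p) = 2 * i"
    using geodesic_between[OF V i] by blast
  have lr: "(Inr l, r) \<in> G" using dist_1_edge V r by blast
  then obtain r0 where r0: "r = Inl r0" "(r0, l) \<in> inc \<Gamma>"
    by (auto simp: incidence_graph_def)
  have near: "pdist p r0 = 2 * i" using r(3) r0(1) dist_sym[of "Inl p" r] by simp
  have other: "pdist p q = 2 * i + 2" if "(q, l) \<in> inc \<Gamma>" "q \<noteq> r0" for q
  proof -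
    have "ldist l p \<noteq> Suc (pdist q p)"
    proof
      assume *: "ldist l p = Suc (pdist q p)"
      have "ldist l p = Suc (pdist r0 p)" using near i dist_sym[of "Inl p" "Inl r0"] by simp
      from projection_on_line_unique[OF that(1) r0(2) assms(1) * this] show False using that by simp
    qed
    then show ?thesis
      using pdist_ldist[OF that(1) assms(1)] i dist_sym[of "Inl p" "Inl q"] by auto
  qed
  have "(\<Sum>q | (q, l) \<in> inc \<Gamma>. alt_geom_sum s (m - pdist p q div 2) :: 'f) =
    alt_geom_sum s (m - pdist p r0 div 2) +
      (\<Sum>q\<in>{q. (q, l) \<in> inc \<Gamma>} - {r0}. alt_geom_sum s (m - pdist p q div 2))"
    using r0(2) by (intro sum.remove finite_points_on) simp
  also have "(\<Sum>q\<in>{q. (q, l) \<in> inc \<Gamma>} - {r0}. alt_geom_sum s (m - pdist p q div 2) :: 'f) =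
    (\<Sum>q\<in>{q. (q, l) \<in> inc \<Gamma>} - {r0}. alt_geom_sum s (m - Suc i))"
    by (intro sum.cong) (simp_all add: other)
  also have "\<dots> = of_nat s * alt_geom_sum s (m - Suc i)"
    using card_points_on[OF assms(2)] finite_points_on r0(2) by simp
  also have "m - pdist p r0 div 2 = Suc (m - Suc i)" using near i_less by simp
  finally show ?thesis by (simp add: alt_geom_sum_Suc)
qed

lemma code_zero_outside:
  assumes "c \<in> code \<Gamma>" "q \<notin> points \<Gamma>"
  shows "c q = 0"
  using assms(1) unfolding code_def
proof (induction rule: fun_space.span_induct_alt)
  case (step a f g)
  then obtain l where l: "l \<in> lines \<Gamma>" "f = line_indicator \<Gamma> l" by blast
  then show ?case
    using step assms(2) inc_in_geometry(1)[of q l] by (auto simp: line_indicator_eq)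
qed simp

text \<open>The sum is linear in c and equals 1 for every line, whatever p is; so the constant is
  the sum of the coefficients of c as a combination of lines.\<close>

lemma code_weight_sum_constant:
  assumes "c \<in> code \<Gamma>"
  shows "\<exists>\<kappa>. \<forall>p\<in>points \<Gamma>. (\<Sum>q\<in>points \<Gamma>. c q * alt_geom_sum s (m - pdist p q div 2)) = \<kappa>"
  using assms unfolding code_def
proof (induction rule: fun_space.span_induct_alt)
  case base
  show ?case by simp
next
  case (step a f g)
  then obtain l where l: "l \<in> lines \<Gamma>" "f = line_indicator \<Gamma> l" by blast
  obtain \<kappa> where \<kappa>: "\<And>p. p \<in> points \<Gamma> \<Longrightarrow>
      (\<Sum>q\<in>points \<Gamma>. g q * alt_geom_sum s (m - pdist p q div 2)) = \<kappa>"
    using step by blast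
  have "(\<Sum>q\<in>points \<Gamma>. f q * alt_geom_sum s (m - pdist p q div 2)) = 1" if p: "p \<in> points \<Gamma>" for p
  proof -
    have "(\<Sum>q\<in>points \<Gamma>. f q * alt_geom_sum s (m - pdist p q div 2)) =
      (\<Sum>q\<in>points \<Gamma>. if (q, l) \<in> inc \<Gamma> then alt_geom_sum s (m - pdist p q div 2) else 0)"
      by (intro sum.cong) (simp_all add: l line_indicator_eq)
    also have "\<dots> = (\<Sum>q\<in>{q \<in> points \<Gamma>. (q, l) \<in> inc \<Gamma>}. alt_geom_sum s (m - pdist p q div 2))"
      by (rule sum.inter_filter[symmetric, OF finite_points])
    also have "{q \<in> points \<Gamma>. (q, l) \<in> inc \<Gamma>} = {q. (q, l) \<in> inc \<Gamma>}"
      using inc_in_geometry(1) by blast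
    finally show ?thesis using line_weight_sum[OF p l(1)] by simp
  qed
  then have "(\<Sum>q\<in>points \<Gamma>. (a * f q + g q) * alt_geom_sum s (m - pdist p q div 2)) = a + \<kappa>"
    if "p \<in> points \<Gamma>" for p
    using \<kappa>[OF that] that
    by (simp add: distrib_right sum.distrib mult.assoc flip: sum_distrib_left)
  then show ?case by (auto simp: plus_fun_def)
qed

lemma support_subset_points: "c \<in> code \<Gamma> \<Longrightarrow> support c \<subseteq> points \<Gamma>"
  using code_zero_outside by (auto simp: support_def)

lemma weight_sum_single:
  assumes "q \<in> points \<Gamma>" "\<And>r. r \<in> support c - {q} \<Longrightarrow> pdist p r = 2 * m"
  shows "(\<Sum>r\<in>points \<Gamma>. c r * alt_geom_sum s (m - pdist p r div 2)) =
    c q * alt_geom_sum s (m - pdist p q div 2)"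
proof -
  have "c r * alt_geom_sum s (m - pdist p r div 2) = 0" if "r \<in> points \<Gamma> - {q}" for r
    using assms(2)[of r] that by (cases "c r = 0") (simp_all add: support_def)
  then have "(\<Sum>r\<in>points \<Gamma> - {q}. c r * alt_geom_sum s (m - pdist p r div 2)) = 0"
    by (intro sum.neutral ballI)
  then show ?thesis by (simp add: sum.remove[OF finite_points assms(1)])
qed

text \<open>If p were opposite the whole support, the constant sum would be 0. Walking from a
  support point q gives r opposite all other support points but not q, where the sum is a nonzero
  multiple of \<open>c q\<close>.\<close>

lemma small_support_blocking:
  fixes c :: "'p \<Rightarrow> 'f::field"
  assumes nz: "\<And>k. k \<in> {1..m} \<Longrightarrow> alt_geom_sum s k \<noteq> (0 :: 'f)"
    and c: "c \<in> code \<Gamma>" "c \<noteq> 0" "card (support c) \<le> s + 1" and p: "p \<in> points \<Gamma>"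
  shows "\<exists>q\<in>support c. pdist p q < 2 * m"
proof (rule ccontr)
  assume "\<not> ?thesis"
  then have opp: "pdist p r = 2 * m" if "r \<in> support c" for r
    using that pdist_le[OF p subsetD[OF support_subset_points[OF c(1)] that]]
    by (meson le_neq_implies_less)
  obtain \<kappa> where \<kappa>: "\<And>p. p \<in> points \<Gamma> \<Longrightarrow>
      (\<Sum>q\<in>points \<Gamma>. c q * alt_geom_sum s (m - pdist p q div 2)) = \<kappa>"
    using code_weight_sum_constant[OF c(1)] by blast
  obtain q where q: "c q \<noteq> 0" using c(2) by (auto simp: fun_eq_iff)
  then have qS: "q \<in> support c" by (simp add: support_def)
  then have qP: "q \<in> points \<Gamma>" using support_subset_points[OF c(1)] by blast
  have "\<kappa> = 0"
    using weight_sum_single[OF qP, of c p] opp opp[OF qS] \<kappa>[OF p] by simp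
  have SP: "support c - {q} \<subseteq> points \<Gamma>" using support_subset_points[OF c(1)] by blast
  have "card (support c - {q}) \<le> s"
    using c(3) qS finite_point_set[OF support_subset_points[OF c(1)]] by simp
  \<comment> \<open>Distinct points have distance at least 2, so m - 1 steps suffice; this is one
    too few to become opposite q.\<close>
  moreover have "2 * m \<le> pdist q r + 2 * (m - 1)" if r: "r \<in> support c - {q}" for r
  proof -
    have rP: "r \<in> points \<Gamma>" using r SP by blast
    have "pdist q r \<noteq> 0" using dist_eq_0[of "Inl q" "Inl r"] qP rP r by auto
    then show ?thesis using pdist_even[OF qP rP] by (auto elim!: evenE)
  qed
  ultimately obtain r where r: "r \<in> points \<Gamma>" "pdist q r \<le> 2 * (m - 1)"
    "\<forall>q'\<in>support c - {q}. pdist r q' = 2 * m"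
    using exists_opposite_to_all[OF SP _ qP] by blast
  have "c q * alt_geom_sum s (m - pdist r q div 2) = 0"
    using weight_sum_single[OF qP, of c r] r(3) \<kappa>[OF r(1)] \<open>\<kappa> = 0\<close> by simp
  moreover have "m - pdist r q div 2 \<in> {1..m}"
    using r(2) dist_sym[of "Inl r" "Inl q"] n_ge by auto
  ultimately show False using q nz by simp
qed

text \<open>A support of at most s points has a common opposite point, contrary to
  \<open>small_support_blocking\<close>.\<close>

lemma weight_ge:
  fixes c :: "'p \<Rightarrow> 'f::field"
  assumes nz: "\<And>k. k \<in> {1..m} \<Longrightarrow> alt_geom_sum s k \<noteq> (0 :: 'f)" and c: "c \<in> code \<Gamma>" "c \<noteq> 0"
  shows "s + 1 \<le> weight c"
proof (rule ccontr)
  assume "\<not> ?thesis"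
  then have small: "card (support c) \<le> s" by (simp add: weight_def)
  obtain q where "c q \<noteq> 0" using c(2) by (auto simp: fun_eq_iff)
  then have q: "q \<in> points \<Gamma>" using code_zero_outside[OF c(1)] by blast
  \<comment> \<open>With m steps the distance condition holds for any starting point.\<close>
  obtain p where p: "p \<in> points \<Gamma>" "\<forall>r\<in>support c. pdist p r = 2 * m"
    using exists_opposite_to_all[OF support_subset_points[OF c(1)] small q, of m] by auto
  show False
    using small_support_blocking[OF nz c _ p(1)] p(2) small by fastforce
qed

lemma support_blocking_set:
  fixes c :: "'p \<Rightarrow> 'f::field"
  assumes nz: "\<And>k. k \<in> {1..m} \<Longrightarrow> alt_geom_sum s k \<noteq> (0 :: 'f)"
    and c: "c \<in> code \<Gamma>" "weight c = s + 1"
  shows "blocking_set \<Gamma> m s t (support c)"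
proof
  show "support c \<subseteq> points \<Gamma>" using c(1) by (rule support_subset_points)
  show "card (support c) = s + 1" using c(2) by (simp add: weight_def)
  have "c \<noteq> 0"
  proof
    assume "c = 0"
    then have "support c = {}" by (simp add: support_def)
    then show False using c(2) by (simp add: weight_def)
  qed
  then show "\<exists>q\<in>support c. pdist p q < 2 * m" if "p \<in> points \<Gamma>" for p
    using small_support_blocking[OF nz c(1) _ _ that] c(2) by (simp add: weight_def)
qed

section \<open>Lines as code words of minimum weight\<close>

lemma support_line_indicator:
  "l \<in> lines \<Gamma> \<Longrightarrow> support (line_indicator \<Gamma> l :: 'p \<Rightarrow> 'f::field) = {p. (p, l) \<in> inc \<Gamma>}"
  by (auto simp: support_def line_indicator_eq)

lemma line_indicator_in_code: "l \<in> lines \<Gamma> \<Longrightarrow> line_indicator \<Gamma> l \<in> code \<Gamma>"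
  unfolding code_def by (intro fun_space.span_base imageI)

lemma lines_nonempty: "lines \<Gamma> \<noteq> {}"
proof -
  obtain x where x: "x \<in> V"
    using weak_polygon by (auto simp: weak_generalised_polygon_def)
  then obtain y where "(x, y) \<in> G" using two_neighbours by blast
  then show ?thesis using inc_in_geometry(2) by (auto simp: incidence_graph_def)
qed

lemma minimum_weight:
  assumes nz: "\<And>k. k \<in> {1..m} \<Longrightarrow> alt_geom_sum s k \<noteq> (0 :: 'f::field)"
  shows "is_minimum_weight (code \<Gamma> :: ('p \<Rightarrow> 'f) set) (s + 1)"
proof -
  obtain l where l: "l \<in> lines \<Gamma>" using lines_nonempty by blast
  have w: "weight (line_indicator \<Gamma> l :: 'p \<Rightarrow> 'f) = s + 1"
    by (simp add: weight_def support_line_indicator[OF l] card_points_on[OF l])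
  moreover have "line_indicator \<Gamma> l \<noteq> (0 :: 'p \<Rightarrow> 'f)"
  proof
    assume "line_indicator \<Gamma> l = (0 :: 'p \<Rightarrow> 'f)"
    then have "support (line_indicator \<Gamma> l :: 'p \<Rightarrow> 'f) = {}" by (simp add: support_def)
    then show False using w by (simp add: weight_def)
  qed
  ultimately show ?thesis
    unfolding is_minimum_weight_def using line_indicator_in_code[OF l] weight_ge[OF nz] by blast
qed

text \<open>Subtracting a suitable multiple of the line from the code word kills one point of
  the support, so that the difference is too light to be nonzero.\<close>

lemma support_line_scalar_multiple:
  fixes c :: "'p \<Rightarrow> 'f::field"
  assumes nz: "\<And>k. k \<in> {1..m} \<Longrightarrow> alt_geom_sum s k \<noteq> (0 :: 'f)"
    and c: "c \<in> code \<Gamma>" and l: "l \<in> lines \<Gamma>" "support c = {p. (p, l) \<in> inc \<Gamma>}"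
  shows "\<exists>a. a \<noteq> 0 \<and> c = (\<lambda>p. a * line_indicator \<Gamma> l p)"
proof -
  have "{p. (p, l) \<in> inc \<Gamma>} \<noteq> {}" using card_points_on[OF l(1)] by force
  then obtain q where q: "(q, l) \<in> inc \<Gamma>" by blast
  then have cq: "c q \<noteq> 0" using l(2) by (auto simp: support_def)
  define b where "b = c - (\<lambda>p. c q * line_indicator \<Gamma> l p)"
  have b_eq: "b p = c p - c q * line_indicator \<Gamma> l p" for p by (simp add: b_def)
  have "b \<in> code \<Gamma>"
    using c line_indicator_in_code[OF l(1)] unfolding b_def code_def
    by (intro fun_space.span_diff fun_space.span_scale)
  moreover have "weight b < s + 1"
  proof -
    have "support b \<subseteq> {p. (p, l) \<in> inc \<Gamma>} - {q}"
      using q l(2) by (auto simp: support_def b_eq line_indicator_eq[OF l(1)])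
    then have "card (support b) \<le> card ({p. (p, l) \<in> inc \<Gamma>} - {q})"
      by (intro card_mono finite_Diff finite_points_on)
    then show ?thesis
      using q card_points_on[OF l(1)] finite_points_on[of l] by (simp add: weight_def)
  qed
  ultimately have "b = 0" using weight_ge[OF nz, of b] by fastforce
  then have "c p = c q * line_indicator \<Gamma> l p" for p
    using b_eq[of p] by simp
  then show ?thesis using cq by blast
qed

end

theorem theorem3p12:
  fixes \<Gamma> :: "('p, 'l) geometry" and m s t :: nat
  assumes "m > 1"
    and "finite_geometry \<Gamma>"
    and "generalised_polygon (2 * m) \<Gamma>"
    and "has_order \<Gamma> s t"
    and "s \<le> t"
    and "\<forall>k\<in>{1..m - 1}. of_int (\<Sum>j=0..k. (- int s) ^ j) \<noteq> (0 :: 'f::field)"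
  shows "is_minimum_weight (code \<Gamma> :: ('p \<Rightarrow> 'f) set) (s + 1) \<and>
    (\<forall>c \<in> (code \<Gamma> :: ('p \<Rightarrow> 'f) set). weight c = s + 1 \<longrightarrow>
       (\<exists>d x y. is_distance_trace m \<Gamma> d x y (support c)) \<and>
       (s < t \<longrightarrow> (\<forall>d x y. is_distance_trace m \<Gamma> d x y (support c) \<longrightarrow> odd d))) \<and>
    (m = 2 \<and> s < t \<longrightarrow>
       (\<forall>c :: 'p \<Rightarrow> 'f. minimum_weight_word (code \<Gamma>) c \<longrightarrow>
          (\<exists>a L. a \<noteq> 0 \<and> L \<in> lines \<Gamma> \<and> c = (\<lambda>p. a * line_indicator \<Gamma> L p))))"
proof -
  interpret even_polygon_order \<Gamma> m s t
    using assms by unfold_locales (simp_all add: generalised_polygon_def)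
  \<comment> \<open>The hypothesis covers k = 2, ..., m with the index shifted by one; k = 1 gives
    the value 1.\<close>
  have nz: "alt_geom_sum s k \<noteq> (0 :: 'f)" if "k \<in> {1..m}" for k
  proof (cases "k = 1")
    case True
    then show ?thesis by (simp add: alt_geom_sum_def)
  next
    case False
    then have "k - 1 \<in> {1..m - 1}" "Suc (k - 1) = k" using that by auto
    then show ?thesis using assms(6) of_int_alt_geom_sum[of s "k - 1"] by metis
  qed
  note min = minimum_weight[OF nz]
  have tr: "\<exists>d x y. is_distance_trace m \<Gamma> d x y (support c)"
    if "c \<in> code \<Gamma>" "weight c = s + 1" for c :: "'p \<Rightarrow> 'f"
    using blocking_set.exists_trace[OF support_blocking_set[OF nz that]] .
  have odd: "odd d" if "c \<in> code \<Gamma>" "weight c = s + 1" "s < t"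
    "is_distance_trace m \<Gamma> d x y (support c)" for c :: "'p \<Rightarrow> 'f" and d x y
    using blocking_set.trace_distance_odd[OF support_blocking_set[OF nz that(1,2)] that(4,3)] .
  have "\<exists>a L. a \<noteq> 0 \<and> L \<in> lines \<Gamma> \<and> c = (\<lambda>p. a * line_indicator \<Gamma> L p)"
    if m: "m = 2" "s < t" and c: "minimum_weight_word (code \<Gamma>) c" for c :: "'p \<Rightarrow> 'f"
  proof -
    note arg_min = c[unfolded minimum_weight_word_def is_arg_min_def]
    have cC: "c \<in> code \<Gamma>" "c \<noteq> 0" using conjunct1[OF arg_min] by simp_all
    have least: "\<not> (\<exists>c' :: 'p \<Rightarrow> 'f. (c' \<in> code \<Gamma> \<and> c' \<noteq> 0) \<and> weight c' < weight c)"
      using conjunct2[OF arg_min] .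
    obtain c' :: "'p \<Rightarrow> 'f" where "c' \<in> code \<Gamma>" "c' \<noteq> 0" "weight c' = s + 1"
      using min unfolding is_minimum_weight_def by blast
    then have "\<not> s + 1 < weight c" using least by metis
    then have w: "weight c = s + 1" using weight_ge[OF nz cC] by simp
    obtain d x y where t: "is_distance_trace m \<Gamma> d x y (support c)"
      using tr[OF cC(1) w] by blast
    have "d \<in> {1..2}" "odd d"
      using odd[OF cC(1) w m(2) t] t m(1) by (auto simp: is_distance_trace_def)
    \<comment> \<open>For m = 2 the only odd d is 1, so the support consists of neighbours of x,
      which is therefore a line.\<close>
    then have "d = 1" by (cases "d = 2") auto
    then have sub: "support c \<subseteq> points_at \<Gamma> 1 x" and x: "x \<in> V" and ne: "support c \<noteq> {}"
      using t by (auto simp: is_distance_trace_def trace_set_def opposite_def)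
    obtain q where q: "q \<in> points_at \<Gamma> 1 x" using sub ne by blast
    then have "\<delta> x (Inl q) = 1" "q \<in> points \<Gamma>"
      using distance_eq_dist_nat[OF x, of "Inl q"] by (auto simp: points_at_def one_enat_def)
    then have "(x, Inl q) \<in> G" using dist_1_edge x by simp
    then obtain L where L: "x = Inr L" "L \<in> lines \<Gamma>"
      using inc_in_geometry(2) by (auto simp: incidence_graph_def)
    have "support c = {p. (p, L) \<in> inc \<Gamma>}"
    proof (rule card_seteq)
      show "support c \<subseteq> {p. (p, L) \<in> inc \<Gamma>}"
        using sub points_at_1_line[OF L(2)] L(1) by simp
      show "card {p. (p, L) \<in> inc \<Gamma>} \<le> card (support c)"
        using w card_points_on[OF L(2)] by (simp add: weight_def)
    qed (rule finite_points_on)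
    from support_line_scalar_multiple[OF nz cC(1) L(2) this] show ?thesis using L(2) by blast
  qed
  with min tr odd show ?thesis by blast
qed

end
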